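(* Let $(T,X)$ be an almost automorphic (a.a.) flow on a nonempty compact Hausdorff space $X$. Then there exist an equicontinuous flow $(T,Y)$ (with $Y$ compact Hausdorff and the same phase group $T$) and an epimorphism $\pi\colon (T,X)\to(T,Y)$ making $(T,X)$ an almost 1-1 extension of $(T,Y)$, such that $$P_{aa}(T,X)=\{x\in X : \pi^{-1}[\pi(x)]=\{x\}\}.$$
   Context: $T$ is a topological semigroup with identity $e$, and phase spaces are nonempty compact Hausdorff. A semiflow $(T,X)$ is a jointly continuous map $T\times X\to X$, $(t,x)\mapsto tx$, with $ex=x$ and $t(sx)=(ts)x$; it is a flow if $T$ is a group. It is minimal if every orbit $Tx$ is dense in $X$. A point $x\in X$ is almost automorphic, written $x\in P_{aa}(T,X)$, if for every net $\{t_n\}$ in $T$ and net $\{x_n'\}$ in $X$: $t_nx\to y$, $x_n'\to x'$ and $t_nx_n'=y$ for all $n$ imply $x=x'$. (For a flow: $t_nx\to y$ and $t_n^{-1}y\to x'$ imply $x=x'$.) $(T,X)$ is an a.a. semiflow (a.a. flow if $T$ is a group) if there is $x\in P_{aa}(T,X)$ with dense orbit. $(T,Y)$ is equicontinuous if for every $y\in Y$ and every entourage $\varepsilon$ of the uniformity of $Y$ there is an entourage $\delta$ such that $(y,y')\in\delta$ implies $(ty,ty')\in\varepsilon$ for all $t\in T$. An epimorphism $\pi\colon(T,X)\to(T,Y)$ is a continuous surjection with $\pi(tx)=t\pi(x)$ for all $t,x$. An epimorphism of two minimal semiflows is of almost 1-1 type, and $(T,X)$ is then called an almost 1-1 extension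 of $(T,Y)$, if there is $y\in Y$ with $\pi^{-1}[y]$ a singleton. *)

theory Defs
  imports "HOL-Analysis.Analysis" "HOL-Algebra.Group"
begin

section \<open>Semiflows and flows\<close>

definition topological_semigroup :: "('g, 'm) monoid_scheme \<Rightarrow> 'g topology \<Rightarrow> bool" where
  "topological_semigroup T \<tau> \<longleftrightarrow>
     monoid T \<and> topspace \<tau> = carrier T \<and>
     continuous_map (prod_topology \<tau> \<tau>) \<tau> (\<lambda>(s, t). s \<otimes>\<^bsub>T\<^esub> t)"

definition semiflow ::
  "('g, 'm) monoid_scheme \<Rightarrow> 'g topology \<Rightarrow> 'x topology \<Rightarrow> ('g \<Rightarrow> 'x \<Rightarrow> 'x) \<Rightarrow> bool" where
  "semiflow T \<tau> X act \<longleftrightarrow>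
     topological_semigroup T \<tau> \<and>
     topspace X \<noteq> {} \<and> compact_space X \<and> Hausdorff_space X \<and>
     continuous_map (prod_topology \<tau> X) X (\<lambda>(t, x). act t x) \<and>
     (\<forall>x\<in>topspace X. act \<one>\<^bsub>T\<^esub> x = x) \<and>
     (\<forall>s\<in>carrier T. \<forall>t\<in>carrier T. \<forall>x\<in>topspace X. act t (act s x) = act (t \<otimes>\<^bsub>T\<^esub> s) x)"

text \<open>No continuity of inversion is required of the phase group.\<close>

definition flow ::
  "('g, 'm) monoid_scheme \<Rightarrow> 'g topology \<Rightarrow> 'x topology \<Rightarrow> ('g \<Rightarrow> 'x \<Rightarrow> 'x) \<Rightarrow> bool" where
  "flow T \<tau> X act \<longleftrightarrow> semiflow T \<tau> X act \<and> group T"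

definition orbit_of :: "('g, 'm) monoid_scheme \<Rightarrow> ('g \<Rightarrow> 'x \<Rightarrow> 'x) \<Rightarrow> 'x \<Rightarrow> 'x set" where
  "orbit_of T act x = (\<lambda>t. act t x) ` carrier T"

definition dense_orbit ::
  "('g, 'm) monoid_scheme \<Rightarrow> 'x topology \<Rightarrow> ('g \<Rightarrow> 'x \<Rightarrow> 'x) \<Rightarrow> 'x \<Rightarrow> bool" where
  "dense_orbit T X act x \<longleftrightarrow> X closure_of (orbit_of T act x) = topspace X"

definition minimal_semiflow ::
  "('g, 'm) monoid_scheme \<Rightarrow> 'g topology \<Rightarrow> 'x topology \<Rightarrow> ('g \<Rightarrow> 'x \<Rightarrow> 'x) \<Rightarrow> bool" where
  "minimal_semiflow T \<tau> X act \<longleftrightarrow>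
     semiflow T \<tau> X act \<and> (\<forall>x\<in>topspace X. dense_orbit T X act x)"

section \<open>Nets and almost automorphic points\<close>

definition directed_index :: "'i set \<Rightarrow> ('i \<Rightarrow> 'i \<Rightarrow> bool) \<Rightarrow> bool" where
  "directed_index D leq \<longleftrightarrow>
     D \<noteq> {} \<and> (\<forall>n\<in>D. leq n n) \<and>
     (\<forall>k\<in>D. \<forall>m\<in>D. \<forall>n\<in>D. leq k m \<longrightarrow> leq m n \<longrightarrow> leq k n) \<and>
     (\<forall>m\<in>D. \<forall>n\<in>D. \<exists>k\<in>D. leq m k \<and> leq n k)"

definition net_converges ::
  "'x topology \<Rightarrow> 'i set \<Rightarrow> ('i \<Rightarrow> 'i \<Rightarrow> bool) \<Rightarrow> ('i \<Rightarrow> 'x) \<Rightarrow> 'x \<Rightarrow> bool" where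
  "net_converges X D leq f l \<longleftrightarrow>
     l \<in> topspace X \<and>
     (\<forall>U. openin X U \<and> l \<in> U \<longrightarrow> (\<exists>m\<in>D. \<forall>n\<in>D. leq m n \<longrightarrow> f n \<in> U))"

text \<open>The condition defining almost automorphy of \<open>x\<close>, for one pair of nets.\<close>

definition aa_condition ::
  "('g, 'm) monoid_scheme \<Rightarrow> 'x topology \<Rightarrow> ('g \<Rightarrow> 'x \<Rightarrow> 'x) \<Rightarrow> 'x \<Rightarrow>
   'i set \<Rightarrow> ('i \<Rightarrow> 'i \<Rightarrow> bool) \<Rightarrow> ('i \<Rightarrow> 'g) \<Rightarrow> ('i \<Rightarrow> 'x) \<Rightarrow> bool" where
  "aa_condition T X act x D leq t x' \<longleftrightarrow>
     directed_index D leq \<longrightarrow> t ` D \<subseteq> carrier T \<longrightarrow> x' ` D \<subseteq> topspace X \<longrightarrow>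
     (\<forall>y z. net_converges X D leq (\<lambda>n. act (t n) x) y \<and> net_converges X D leq x' z \<and>
            (\<forall>n\<in>D. act (t n) (x' n) = y) \<longrightarrow> x = z)"

text \<open>A definition cannot quantify over all index types, so nets are indexed here by directed
  sets in the type \<open>('g \<times> 'x) set \<times> ('g \<times> 'x)\<close>. Lemma \<open>aa_points_arbitrary_net\<close> below shows
  that this covers nets over every index type.\<close>

definition aa_points ::
  "('g, 'm) monoid_scheme \<Rightarrow> 'x topology \<Rightarrow> ('g \<Rightarrow> 'x \<Rightarrow> 'x) \<Rightarrow> 'x set" where
  "aa_points T X act =
     {x \<in> topspace X.
        \<forall>(D :: (('g \<times> 'x) set \<times> ('g \<times> 'x)) set) leq t x'. aa_condition T X act x D leq t x'}"

definition aa_semiflow ::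
  "('g, 'm) monoid_scheme \<Rightarrow> 'g topology \<Rightarrow> 'x topology \<Rightarrow> ('g \<Rightarrow> 'x \<Rightarrow> 'x) \<Rightarrow> bool" where
  "aa_semiflow T \<tau> X act \<longleftrightarrow>
     semiflow T \<tau> X act \<and> (\<exists>x\<in>aa_points T X act. dense_orbit T X act x)"

definition aa_flow ::
  "('g, 'm) monoid_scheme \<Rightarrow> 'g topology \<Rightarrow> 'x topology \<Rightarrow> ('g \<Rightarrow> 'x \<Rightarrow> 'x) \<Rightarrow> bool" where
  "aa_flow T \<tau> X act \<longleftrightarrow> aa_semiflow T \<tau> X act \<and> group T"

lemma aa_points_arbitrary_net:
  fixes D :: "'i set" and X :: "'x topology" and T :: "('g, 'm) monoid_scheme"
  assumes "x \<in> aa_points T X act"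
  shows "aa_condition T X act x D leq t x'"
  unfolding aa_condition_def
proof (intro impI allI, elim conjE)
  fix y z
  assume dir: "directed_index D leq" and t: "t ` D \<subseteq> carrier T" and x': "x' ` D \<subseteq> topspace X"
    and cy: "net_converges X D leq (\<lambda>n. act (t n) x) y" and cz: "net_converges X D leq x' z"
    and eq: "\<forall>n\<in>D. act (t n) (x' n) = y"
  define tail where "tail m = (\<lambda>n. (t n, x' n)) ` {n\<in>D. leq m n}" for m
  define E where "E = {(A, p). \<exists>m\<in>D. A = tail m \<and> p \<in> A}"
  define leE where "leE a b \<longleftrightarrow> fst b \<subseteq> fst a" for a b :: "('g \<times> 'x) set \<times> ('g \<times> 'x)"
  have refl: "leq n n" if "n \<in> D" for n
    using dir that by (simp add: directed_index_def)
  have trans: "leq k n" if "k \<in> D" "m \<in> D" "n \<in> D" "leq k m" "leq m n" for k m n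
    using dir that unfolding directed_index_def by blast
  have inE: "(tail m, (t m, x' m)) \<in> E" if "m \<in> D" for m
    using that refl by (auto simp: E_def tail_def)
  have dirE: "directed_index E leE"
    unfolding directed_index_def
  proof (intro conjI ballI impI)
    show "E \<noteq> {}" using inE dir unfolding directed_index_def by blast
    show "leE n n" for n by (simp add: leE_def)
    show "leE k n" if "leE k m" "leE m n" for k m n using that by (auto simp: leE_def)
    fix a b assume "a \<in> E" "b \<in> E"
    then obtain m n where mn: "m \<in> D" "n \<in> D" "fst a = tail m" "fst b = tail n"
      by (auto simp: E_def)
    then obtain k where k: "k \<in> D" "leq m k" "leq n k"
      using dir unfolding directed_index_def by blast
    then have "tail k \<subseteq> tail m" "tail k \<subseteq> tail n"
      using mn trans unfolding tail_def by blast+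
    then show "\<exists>c\<in>E. leE a c \<and> leE b c"
      using inE[OF k(1)] mn by (intro bexI[of _ "(tail k, (t k, x' k))"]) (auto simp: leE_def)
  qed
  have conv: "net_converges X E leE (\<lambda>a. h (snd a)) l"
    if c: "net_converges X D leq (\<lambda>n. h (t n, x' n)) l" for h l
    unfolding net_converges_def
  proof (intro conjI allI impI, goal_cases)
    case 1 then show ?case using c by (simp add: net_converges_def)
  next
    case (2 U)
    then obtain m where m: "m \<in> D" "\<forall>n\<in>D. leq m n \<longrightarrow> h (t n, x' n) \<in> U"
      using c unfolding net_converges_def by blast
    have "h (snd a) \<in> U" if "a \<in> E" "leE (tail m, (t m, x' m)) a" for a
    proof -
      have "snd a \<in> tail m" using that by (auto simp: E_def leE_def)
      then show ?thesis using m(2) by (auto simp: tail_def)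
    qed
    then show ?case using inE[OF m(1)] by blast
  qed
  have E_D: "\<exists>n\<in>D. snd a = (t n, x' n)" if "a \<in> E" for a
    using that by (auto simp: E_def tail_def)
  have "aa_condition T X act x E leE (\<lambda>a. fst (snd a)) (\<lambda>a. snd (snd a))"
    using assms unfolding aa_points_def by blast
  moreover have "(\<lambda>a. fst (snd a)) ` E \<subseteq> carrier T" "(\<lambda>a. snd (snd a)) ` E \<subseteq> topspace X"
    using E_D t x' by (force simp: image_subset_iff)+
  moreover have "net_converges X E leE (\<lambda>a. act (fst (snd a)) x) y"
    using conv[of "\<lambda>p. act (fst p) x" y] cy by simp
  moreover have "net_converges X E leE (\<lambda>a. snd (snd a)) z"
    using conv[of snd z] cz by simp
  moreover have "\<forall>a\<in>E. act (fst (snd a)) (snd (snd a)) = y"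
    using E_D eq by fastforce
  ultimately show "x = z"
    using dirE unfolding aa_condition_def by blast
qed

section \<open>The uniformity of a compact Hausdorff space\<close>

definition compatible_uniformity :: "'y topology \<Rightarrow> ('y \<times> 'y) set set \<Rightarrow> bool" where
  "compatible_uniformity Y \<U> \<longleftrightarrow>
     \<U> \<noteq> {} \<and>
     (\<forall>E\<in>\<U>. Id_on (topspace Y) \<subseteq> E \<and> E \<subseteq> topspace Y \<times> topspace Y) \<and>
     (\<forall>E\<in>\<U>. \<forall>F. E \<subseteq> F \<and> F \<subseteq> topspace Y \<times> topspace Y \<longrightarrow> F \<in> \<U>) \<and>
     (\<forall>E\<in>\<U>. \<forall>F\<in>\<U>. E \<inter> F \<in> \<U>) \<and>
     (\<forall>E\<in>\<U>. E\<inverse> \<in> \<U>) \<and>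
     (\<forall>E\<in>\<U>. \<exists>F\<in>\<U>. F O F \<subseteq> E) \<and>
     (\<forall>A. openin Y A \<longleftrightarrow> A \<subseteq> topspace Y \<and> (\<forall>x\<in>A. \<exists>E\<in>\<U>. E `` {x} \<subseteq> A))"

text \<open>Meaningful for compact Hausdorff \<open>Y\<close>, where the compatible uniformity exists and is unique;
  see \<open>compatible_uniformity_iff\<close>.\<close>

definition entourages :: "'y topology \<Rightarrow> ('y \<times> 'y) set set" where
  "entourages Y = (THE \<U>. compatible_uniformity Y \<U>)"

definition diagonal_nhds :: "'y topology \<Rightarrow> ('y \<times> 'y) set set" where
  "diagonal_nhds Y =
     {E. E \<subseteq> topspace Y \<times> topspace Y \<and>
         (\<exists>W. openin (prod_topology Y Y) W \<and> Id_on (topspace Y) \<subseteq> W \<and> W \<subseteq> E)}"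

lemma compatible_uniformity_diagonal_nhds:
  assumes comp: "compact_space Y" and haus: "Hausdorff_space Y"
  shows "compatible_uniformity Y (diagonal_nhds Y)"
proof -
  let ?S = "topspace Y" and ?P = "prod_topology Y Y"
  have memI: "W \<in> diagonal_nhds Y" if "openin ?P W" "Id_on ?S \<subseteq> W" for W
    using that openin_subset[OF that(1)] by (auto simp: diagonal_nhds_def)
  have top: "?S \<times> ?S \<in> diagonal_nhds Y"
    by (intro memI) (auto simp: openin_prod_Times_iff)
  have int: "E \<inter> F \<in> diagonal_nhds Y" if EF: "E \<in> diagonal_nhds Y" "F \<in> diagonal_nhds Y" for E F
  proof -
    obtain V W where "openin ?P V" "Id_on ?S \<subseteq> V" "V \<subseteq> E" "openin ?P W" "Id_on ?S \<subseteq> W" "W \<subseteq> F"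
      using EF unfolding diagonal_nhds_def by blast
    then have "openin ?P (V \<inter> W) \<and> Id_on ?S \<subseteq> V \<inter> W \<and> V \<inter> W \<subseteq> E \<inter> F"
      by blast
    then show ?thesis using EF unfolding diagonal_nhds_def by blast
  qed
  have conv: "E\<inverse> \<in> diagonal_nhds Y" if E: "E \<in> diagonal_nhds Y" for E
  proof -
    obtain W where W: "openin ?P W" "Id_on ?S \<subseteq> W" "W \<subseteq> E"
      using E unfolding diagonal_nhds_def by blast
    have sw: "continuous_map ?P ?P (\<lambda>(x, y). (y, x))"
      by (simp add: case_prod_unfold continuous_map_pairedI continuous_map_fst continuous_map_snd)
    have "{p \<in> topspace ?P. (\<lambda>(x, y). (y, x)) p \<in> W} = W\<inverse>"
      using openin_subset[OF W(1)] by auto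
    then have "openin ?P (W\<inverse>)"
      using openin_continuous_map_preimage[OF sw W(1)] by simp
    then show ?thesis
      using W E unfolding diagonal_nhds_def by blast
  qed
  have half: "\<exists>F\<in>diagonal_nhds Y. F O F \<subseteq> E" if E: "E \<in> diagonal_nhds Y" for E
  proof -
    obtain W where W: "openin ?P W" "Id_on ?S \<subseteq> W" "W \<subseteq> E"
      using E unfolding diagonal_nhds_def by blast
    have "\<exists>A B C. openin Y A \<and> openin Y B \<and> closedin Y C \<and> x \<in> B \<and> B \<subseteq> C \<and> C \<subseteq> A \<and> A \<times> A \<subseteq> W"
      if x: "x \<in> ?S" for x
    proof -
      have "(x, x) \<in> W" using W x by auto
      then obtain U V where UV: "openin Y U" "openin Y V" "x \<in> U" "x \<in> V" "U \<times> V \<subseteq> W"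
        using openin_prod_topology_alt[THEN iffD1, rule_format, OF W(1)] by metis
      have "neighbourhood_base_of (closedin Y) Y"
        using comp haus compact_Hausdorff_imp_regular_space neighbourhood_base_of_closedin by blast
      moreover have "openin Y (U \<inter> V)" "x \<in> U \<inter> V" using UV by auto
      ultimately obtain B C where "openin Y B" "closedin Y C" "x \<in> B" "B \<subseteq> C" "C \<subseteq> U \<inter> V"
        unfolding neighbourhood_base_of by meson
      moreover have "(U \<inter> V) \<times> (U \<inter> V) \<subseteq> W" using UV by auto
      ultimately show ?thesis using \<open>openin Y (U \<inter> V)\<close> by meson
    qed
    then obtain A B C where ABC: "\<And>x. x \<in> ?S \<Longrightarrow> openin Y (A x) \<and> openin Y (B x) \<and> closedin Y (C x) \<and>
        x \<in> B x \<and> B x \<subseteq> C x \<and> C x \<subseteq> A x \<and> A x \<times> A x \<subseteq> W" by metis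
    have "(\<forall>U\<in>B ` ?S. openin Y U) \<and> ?S \<subseteq> \<Union>(B ` ?S)" using ABC by blast
    then obtain \<F> where "finite \<F>" "\<F> \<subseteq> B ` ?S" "?S \<subseteq> \<Union>\<F>"
      using comp unfolding compact_space_alt by metis
    then obtain K where K: "finite K" "K \<subseteq> ?S" "?S \<subseteq> (\<Union>x\<in>K. B x)"
      by (metis finite_subset_image)
    define V where "V x = A x \<times> A x \<union> (?S - C x) \<times> (?S - C x)" for x
    have VK: "V x \<in> diagonal_nhds Y" if "x \<in> K" for x
    proof -
      have *: "openin Y (A x)" "openin Y (?S - C x)" "C x \<subseteq> A x" using ABC K that by blast+
      then have "openin ?P (V x)"
        unfolding V_def by (intro openin_Un) (simp_all add: openin_prod_Times_iff)
      then show ?thesis using * by (intro memI) (auto simp: V_def)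
    qed
    have F: "(?S \<times> ?S) \<inter> (\<Inter>x\<in>K. V x) \<in> diagonal_nhds Y" (is "?F \<in> _")
      using K(1) VK
    proof (induction K rule: finite_induct)
      case empty then show ?case using top by simp
    next
      case (insert a K)
      then have "V a \<in> diagonal_nhds Y" "(?S \<times> ?S) \<inter> (\<Inter>x\<in>K. V x) \<in> diagonal_nhds Y"
        by simp_all
      then have "V a \<inter> ((?S \<times> ?S) \<inter> (\<Inter>x\<in>K. V x)) \<in> diagonal_nhds Y"
        by (rule int)
      then show ?case by (simp add: Int_ac)
    qed
    have "?F O ?F \<subseteq> W"
    proof (rule subrelI)
      fix x z assume "(x, z) \<in> ?F O ?F"
      then obtain y where xy: "(x, y) \<in> ?S \<times> ?S" "(x, y) \<in> (\<Inter>x\<in>K. V x)"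
        and yz: "(y, z) \<in> (\<Inter>x\<in>K. V x)" by auto
      obtain k where k: "k \<in> K" "y \<in> B k" using K xy by blast
      then have "y \<in> C k" "A k \<times> A k \<subseteq> W" using ABC K by blast+
      moreover have "(x, y) \<in> V k" "(y, z) \<in> V k" using xy yz k by auto
      ultimately show "(x, z) \<in> W" by (auto simp: V_def)
    qed
    then have "?F O ?F \<subseteq> E" using W(3) by (rule subset_trans)
    then show ?thesis using F by (rule bexI)
  qed
  have opn: "openin Y A \<longleftrightarrow> A \<subseteq> ?S \<and> (\<forall>x\<in>A. \<exists>E\<in>diagonal_nhds Y. E `` {x} \<subseteq> A)" for A
  proof
    assume A: "openin Y A"
    have "\<exists>E\<in>diagonal_nhds Y. E `` {x} \<subseteq> A" if x: "x \<in> A" for x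
    proof -
      have "x \<in> ?S" using x openin_subset[OF A] by blast
      then have "openin Y (?S - {x})"
        using haus by (simp add: closedin_Hausdorff_singleton openin_diff)
      then have "openin ?P (A \<times> A \<union> (?S - {x}) \<times> ?S)"
        using A by (intro openin_Un) (simp_all add: openin_prod_Times_iff)
      then have "A \<times> A \<union> (?S - {x}) \<times> ?S \<in> diagonal_nhds Y"
        using x by (intro memI) auto
      then show ?thesis by (rule bexI[rotated]) auto
    qed
    then show "A \<subseteq> ?S \<and> (\<forall>x\<in>A. \<exists>E\<in>diagonal_nhds Y. E `` {x} \<subseteq> A)"
      using openin_subset[OF A] by blast
  next
    assume R: "A \<subseteq> ?S \<and> (\<forall>x\<in>A. \<exists>E\<in>diagonal_nhds Y. E `` {x} \<subseteq> A)"
    show "openin Y A"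
    proof (subst openin_subopen, intro ballI)
      fix x assume x: "x \<in> A"
      then obtain E W where W: "E `` {x} \<subseteq> A" "openin ?P W" "Id_on ?S \<subseteq> W" "W \<subseteq> E"
        using R unfolding diagonal_nhds_def by blast
      have "(x, x) \<in> W" using W x R by auto
      then obtain U V where "openin Y U" "openin Y V" "x \<in> U" "x \<in> V" "U \<times> V \<subseteq> W"
        using openin_prod_topology_alt[THEN iffD1, rule_format, OF W(2)] by metis
      then show "\<exists>T. openin Y T \<and> x \<in> T \<and> T \<subseteq> A"
        using W by (intro exI[of _ V]) blast
    qed
  qed
  show ?thesis
    unfolding compatible_uniformity_def
  proof (intro conjI)
    show "diagonal_nhds Y \<noteq> {}" using top by blast
    show "\<forall>E\<in>diagonal_nhds Y. Id_on ?S \<subseteq> E \<and> E \<subseteq> ?S \<times> ?S"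
      unfolding diagonal_nhds_def by (simp, meson subset_trans)
    show "\<forall>E\<in>diagonal_nhds Y. \<forall>F. E \<subseteq> F \<and> F \<subseteq> ?S \<times> ?S \<longrightarrow> F \<in> diagonal_nhds Y"
    proof (intro ballI allI impI)
      fix E F assume E: "E \<in> diagonal_nhds Y" and F: "E \<subseteq> F \<and> F \<subseteq> ?S \<times> ?S"
      obtain W where "openin ?P W" "Id_on ?S \<subseteq> W" "W \<subseteq> E"
        using E unfolding diagonal_nhds_def by blast
      moreover from this have "W \<subseteq> F" using F by (meson subset_trans)
      ultimately show "F \<in> diagonal_nhds Y" using F unfolding diagonal_nhds_def by simp metis
    qed
    show "\<forall>E\<in>diagonal_nhds Y. \<forall>F\<in>diagonal_nhds Y. E \<inter> F \<in> diagonal_nhds Y"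
      by (intro ballI int)
    show "\<forall>E\<in>diagonal_nhds Y. E\<inverse> \<in> diagonal_nhds Y"
      by (intro ballI conv)
    show "\<forall>E\<in>diagonal_nhds Y. \<exists>F\<in>diagonal_nhds Y. F O F \<subseteq> E"
      by (intro ballI half)
    show "\<forall>A. openin Y A \<longleftrightarrow> A \<subseteq> ?S \<and> (\<forall>x\<in>A. \<exists>E\<in>diagonal_nhds Y. E `` {x} \<subseteq> A)"
      by (intro allI opn)
  qed
qed

lemma compatible_uniformity_unique:
  assumes comp: "compact_space Y" and u: "compatible_uniformity Y \<U>"
  shows "\<U> = diagonal_nhds Y"
proof -
  let ?S = "topspace Y" and ?P = "prod_topology Y Y"
  note u' = u[unfolded compatible_uniformity_def]
  have ne: "\<U> \<noteq> {}"
    using u'[THEN conjunct1] by blast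
  have sub: "\<And>E. E \<in> \<U> \<Longrightarrow> Id_on ?S \<subseteq> E \<and> E \<subseteq> ?S \<times> ?S"
    using u'[THEN conjunct2, THEN conjunct1] by blast
  have up: "\<And>E F. E \<in> \<U> \<Longrightarrow> E \<subseteq> F \<Longrightarrow> F \<subseteq> ?S \<times> ?S \<Longrightarrow> F \<in> \<U>"
    using u'[THEN conjunct2, THEN conjunct2, THEN conjunct1] by blast
  have int: "\<And>E F. E \<in> \<U> \<Longrightarrow> F \<in> \<U> \<Longrightarrow> E \<inter> F \<in> \<U>"
    using u'[THEN conjunct2, THEN conjunct2, THEN conjunct2, THEN conjunct1] by blast
  have conv: "\<And>E. E \<in> \<U> \<Longrightarrow> E\<inverse> \<in> \<U>"
    using u'[THEN conjunct2, THEN conjunct2, THEN conjunct2, THEN conjunct2, THEN conjunct1] by blast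
  have half: "\<And>E. E \<in> \<U> \<Longrightarrow> \<exists>F\<in>\<U>. F O F \<subseteq> E"
    using u'[THEN conjunct2, THEN conjunct2, THEN conjunct2, THEN conjunct2, THEN conjunct2, THEN conjunct1] by blast
  have opn: "\<And>A. openin Y A \<longleftrightarrow> A \<subseteq> ?S \<and> (\<forall>x\<in>A. \<exists>E\<in>\<U>. E `` {x} \<subseteq> A)"
    using u'[THEN conjunct2, THEN conjunct2, THEN conjunct2, THEN conjunct2, THEN conjunct2, THEN conjunct2] by (rule spec)
  have nhd: "\<exists>N. openin Y N \<and> x \<in> N \<and> N \<subseteq> D `` {x}" if D: "D \<in> \<U>" and x: "x \<in> ?S" for D x
  proof -
    define N where "N = {y \<in> ?S. \<exists>F\<in>\<U>. F `` {y} \<subseteq> D `` {x}}"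
    have "openin Y N"
      unfolding opn
    proof (intro conjI ballI)
      show "N \<subseteq> ?S" by (auto simp: N_def)
      fix y assume "y \<in> N"
      then obtain F where F: "F \<in> \<U>" "F `` {y} \<subseteq> D `` {x}" by (auto simp: N_def)
      obtain G where G: "G \<in> \<U>" "G O G \<subseteq> F" using half[OF F(1)] by blast
      have "z \<in> N" if "(y, z) \<in> G" for z
      proof -
        have "G `` {z} \<subseteq> D `` {x}" using that G F by blast
        moreover have "z \<in> ?S" using that sub[OF G(1)] by blast
        ultimately show ?thesis using G(1) by (auto simp: N_def)
      qed
      then show "\<exists>E\<in>\<U>. E `` {y} \<subseteq> N" using G(1) by blast
    qed
    moreover have "x \<in> N" using x D by (auto simp: N_def)
    moreover have "N \<subseteq> D `` {x}"
    proof
      fix y assume "y \<in> N"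
      then obtain F where F: "F \<in> \<U>" "F `` {y} \<subseteq> D `` {x}" "y \<in> ?S" by (auto simp: N_def)
      then have "(y, y) \<in> F" using sub by blast
      then show "y \<in> D `` {x}" using F by blast
    qed
    ultimately show ?thesis by blast
  qed
  have "E \<in> diagonal_nhds Y" if E: "E \<in> \<U>" for E
  proof -
    obtain F where F: "F \<in> \<U>" "F O F \<subseteq> E" using half[OF E] by blast
    define D where "D = F \<inter> F\<inverse>"
    have D: "D \<in> \<U>" using F conv int by (simp add: D_def)
    then obtain N where N: "\<And>x. x \<in> ?S \<Longrightarrow> openin Y (N x) \<and> x \<in> N x \<and> N x \<subseteq> D `` {x}"
      using nhd by metis
    define W where "W = (\<Union>x\<in>?S. N x \<times> N x)"
    have "openin ?P W"
      unfolding W_def using N by (intro openin_Union) (auto simp: openin_prod_Times_iff)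
    moreover have "Id_on ?S \<subseteq> W" using N by (auto simp: W_def)
    moreover have "W \<subseteq> E"
    proof
      fix p assume "p \<in> W"
      then obtain x y z where *: "p = (y, z)" "x \<in> ?S" "y \<in> N x" "z \<in> N x" by (auto simp: W_def)
      then have "(x, y) \<in> D" "(x, z) \<in> D" using N by blast+
      then have "(y, x) \<in> F" "(x, z) \<in> F" by (auto simp: D_def)
      then show "p \<in> E" using F * by blast
    qed
    ultimately show ?thesis using sub[OF E] unfolding diagonal_nhds_def by blast
  qed
  moreover have "E \<in> \<U>" if E: "E \<in> diagonal_nhds Y" for E
  proof -
    obtain W where W: "openin ?P W" "Id_on ?S \<subseteq> W" "W \<subseteq> E" "E \<subseteq> ?S \<times> ?S"
      using E unfolding diagonal_nhds_def by blast
    have "\<exists>N D. openin Y N \<and> x \<in> N \<and> D \<in> \<U> \<and> (\<forall>y\<in>N. \<forall>z. (y, z) \<in> D \<longrightarrow> (y, z) \<in> W)"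
      if x: "x \<in> ?S" for x
    proof -
      have "(x, x) \<in> W" using W x by auto
      then obtain U V where UV: "openin Y U" "openin Y V" "x \<in> U" "x \<in> V" "U \<times> V \<subseteq> W"
        using openin_prod_topology_alt[THEN iffD1, rule_format, OF W(1)] by metis
      obtain F where F: "F \<in> \<U>" "F `` {x} \<subseteq> V" using opn UV by blast
      obtain G where G: "G \<in> \<U>" "G O G \<subseteq> F" using half[OF F(1)] by blast
      obtain N where N: "openin Y N" "x \<in> N" "N \<subseteq> G `` {x}" using nhd[OF G(1) x] by blast
      have "(y, z) \<in> W" if "y \<in> N \<inter> U" "(y, z) \<in> G" for y z
      proof -
        have "(x, y) \<in> G" using that N by blast
        then have "z \<in> V" using that G F by blast
        then show ?thesis using that UV by blast
      qed
      moreover have "openin Y (N \<inter> U)" "x \<in> N \<inter> U" using N UV by auto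
      ultimately show ?thesis using G(1) by blast
    qed
    then obtain N D where ND: "\<And>x. x \<in> ?S \<Longrightarrow> openin Y (N x) \<and> x \<in> N x \<and> D x \<in> \<U> \<and>
        (\<forall>y\<in>N x. \<forall>z. (y, z) \<in> D x \<longrightarrow> (y, z) \<in> W)" by metis
    have "(\<forall>U\<in>N ` ?S. openin Y U) \<and> ?S \<subseteq> \<Union>(N ` ?S)" using ND by blast
    then obtain \<F> where "finite \<F>" "\<F> \<subseteq> N ` ?S" "?S \<subseteq> \<Union>\<F>"
      using comp unfolding compact_space_alt by metis
    then obtain K where K: "finite K" "K \<subseteq> ?S" "?S \<subseteq> (\<Union>x\<in>K. N x)"
      by (metis finite_subset_image)
    obtain E0 where "E0 \<in> \<U>" using ne by auto
    then have top: "?S \<times> ?S \<in> \<U>" using sub up[of E0 "?S \<times> ?S"] by simp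
    have DK: "\<forall>x\<in>K. D x \<in> \<U>" using K ND by blast
    have F: "(?S \<times> ?S) \<inter> (\<Inter>x\<in>K. D x) \<in> \<U>" (is "?F \<in> _")
      using K(1) DK
    proof (induction K rule: finite_induct)
      case empty then show ?case using top by simp
    next
      case (insert a K)
      then have "D a \<in> \<U>" "(?S \<times> ?S) \<inter> (\<Inter>x\<in>K. D x) \<in> \<U>"
        by simp_all
      then have "D a \<inter> ((?S \<times> ?S) \<inter> (\<Inter>x\<in>K. D x)) \<in> \<U>"
        by (rule int)
      then show ?case by (simp add: Int_ac)
    qed
    have "?F \<subseteq> W"
    proof (rule subrelI)
      fix y z assume "(y, z) \<in> ?F"
      then have yz: "y \<in> ?S" "(y, z) \<in> (\<Inter>x\<in>K. D x)" by auto
      then obtain k where "k \<in> K" "y \<in> N k" using K by blast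
      then show "(y, z) \<in> W" using ND K yz by blast
    qed
    then have "?F \<subseteq> E" using W(3) by (rule subset_trans)
    then show ?thesis using up[OF F] W(4) by simp
  qed
  ultimately show ?thesis by blast
qed

lemma compatible_uniformity_iff:
  assumes "compact_space Y" "Hausdorff_space Y"
  shows "compatible_uniformity Y \<U> \<longleftrightarrow> \<U> = diagonal_nhds Y"
  using compatible_uniformity_diagonal_nhds[OF assms] compatible_uniformity_unique[OF assms(1)]
  by blast

lemma entourages_eq_diagonal_nhds:
  assumes "compact_space Y" "Hausdorff_space Y"
  shows "entourages Y = diagonal_nhds Y"
  unfolding entourages_def by (rule the_equality) (simp_all only: compatible_uniformity_iff[OF assms])

section \<open>Equicontinuity and extensions\<close>

definition equicontinuous_semiflow ::
  "('g, 'm) monoid_scheme \<Rightarrow> 'g topology \<Rightarrow> 'y topology \<Rightarrow> ('g \<Rightarrow> 'y \<Rightarrow> 'y) \<Rightarrow> bool" where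
  "equicontinuous_semiflow T \<tau> Y act \<longleftrightarrow>
     semiflow T \<tau> Y act \<and>
     (\<forall>y\<in>topspace Y. \<forall>\<epsilon>\<in>entourages Y. \<exists>\<delta>\<in>entourages Y. \<forall>y'.
        (y, y') \<in> \<delta> \<longrightarrow> (\<forall>t\<in>carrier T. (act t y, act t y') \<in> \<epsilon>))"

definition epimorphism ::
  "('g, 'm) monoid_scheme \<Rightarrow> 'x topology \<Rightarrow> ('g \<Rightarrow> 'x \<Rightarrow> 'x) \<Rightarrow>
   'y topology \<Rightarrow> ('g \<Rightarrow> 'y \<Rightarrow> 'y) \<Rightarrow> ('x \<Rightarrow> 'y) \<Rightarrow> bool" where
  "epimorphism T X actX Y actY \<pi> \<longleftrightarrow>
     continuous_map X Y \<pi> \<and> \<pi> ` topspace X = topspace Y \<and>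
     (\<forall>t\<in>carrier T. \<forall>x\<in>topspace X. \<pi> (actX t x) = actY t (\<pi> x))"

definition fibre :: "'x topology \<Rightarrow> ('x \<Rightarrow> 'y) \<Rightarrow> 'y \<Rightarrow> 'x set" where
  "fibre X \<pi> y = {x \<in> topspace X. \<pi> x = y}"

definition almost_one_to_one_extension ::
  "('g, 'm) monoid_scheme \<Rightarrow> 'g topology \<Rightarrow> 'x topology \<Rightarrow> ('g \<Rightarrow> 'x \<Rightarrow> 'x) \<Rightarrow>
   'y topology \<Rightarrow> ('g \<Rightarrow> 'y \<Rightarrow> 'y) \<Rightarrow> ('x \<Rightarrow> 'y) \<Rightarrow> bool" where
  "almost_one_to_one_extension T \<tau> X actX Y actY \<pi> \<longleftrightarrow>
     minimal_semiflow T \<tau> X actX \<and> minimal_semiflow T \<tau> Y actY \<and>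
     epimorphism T X actX Y actY \<pi> \<and>
     (\<exists>y\<in>topspace Y. \<exists>x. fibre X \<pi> y = {x})"

end

theory Submission
  imports Defs
begin

text \<open>Let \<open>a\<close> be almost automorphic with dense orbit. The central point is that for every
  neighbourhood \<open>U\<close> of \<open>a\<close> there is a neighbourhood \<open>V\<close> of \<open>a\<close> such that \<open>s a, t a \<in> V\<close> implies
  \<open>s\<inverse> t a \<in> U\<close>. Hence the left-invariant relations \<open>t\<inverse> s a \<in> U\<close> on the orbit of \<open>a\<close> form the base
  of a uniformity. Since the flow is minimal, any two orbit points near the same
  \<open>x \<in> X\<close> can be translated to lie near \<open>a\<close>, so this uniformity extends to an invariant one on \<open>X\<close>
  that is coarser than the original one. Taking all almost automorphic points \<open>a\<close> together, the
  quotient of \<open>X\<close> by the intersection of these entourages is an equicontinuous flow in which almost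
  automorphic points are not identified with any other point. Conversely, equicontinuity of the
  quotient forces every point with a singleton fibre to be almost automorphic.\<close>

section \<open>Quotients of compact group flows\<close>

locale group_flow =
  fixes T :: "('g, 'm) monoid_scheme" (structure)
    and \<tau> :: "'g topology" and X :: "'x topology" and act :: "'g \<Rightarrow> 'x \<Rightarrow> 'x"
  assumes flow: "flow T \<tau> X act"
begin

sublocale group T
  using flow by (simp add: flow_def)

section \<open>Elementary properties of the action\<close>

lemma compact: "compact_space X"
  and Hausdorff: "Hausdorff_space X"
  and nonempty: "topspace X \<noteq> {}"
  and topspace_group: "topspace \<tau> = carrier T"
  and continuous_action: "continuous_map (prod_topology \<tau> X) X (\<lambda>(t, x). act t x)"
  and act_one: "x \<in> topspace X \<Longrightarrow> act \<one> x = x"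
  and act_act: "\<lbrakk>s \<in> carrier T; t \<in> carrier T; x \<in> topspace X\<rbrakk> \<Longrightarrow> act t (act s x) = act (t \<otimes> s) x"
  using flow by (auto simp: flow_def semiflow_def topological_semigroup_def)

lemma continuous_act: "t \<in> carrier T \<Longrightarrow> continuous_map X X (act t)"
  using continuous_map_compose[OF _ continuous_action, of X "\<lambda>x. (t, x)"]
  by (simp add: comp_def continuous_map_paired topspace_group)

lemma act_closed: "\<lbrakk>t \<in> carrier T; x \<in> topspace X\<rbrakk> \<Longrightarrow> act t x \<in> topspace X"
  using continuous_act continuous_map_image_subset_topspace by blast

lemma act_inv_act: "\<lbrakk>t \<in> carrier T; x \<in> topspace X\<rbrakk> \<Longrightarrow> act (inv t) (act t x) = x"
  and act_act_inv: "\<lbrakk>t \<in> carrier T; x \<in> topspace X\<rbrakk> \<Longrightarrow> act t (act (inv t) x) = x"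
  by (simp_all add: act_act act_one)

text \<open>Left translation does not change \<open>inv s \<otimes> t\<close>. This makes the
  entourages below invariant and lets the products built in \<open>aa_point_division\<close>
  telescope.\<close>

lemma inv_mult_cancel_left:
  assumes "c \<in> carrier T" "s \<in> carrier T" "t \<in> carrier T"
  shows "inv (c \<otimes> s) \<otimes> (c \<otimes> t) = inv s \<otimes> t"
proof -
  have "inv c \<otimes> (c \<otimes> t) = t" using assms by (simp flip: m_assoc)
  then show ?thesis using assms by (simp add: inv_mult_group m_assoc)
qed

lemma openin_act_preimage:
  "\<lbrakk>t \<in> carrier T; openin X U\<rbrakk> \<Longrightarrow> openin X {x \<in> topspace X. act t x \<in> U}"
  using continuous_act openin_continuous_map_preimage by blast

lemma dense_orbit_iff:
  assumes "x \<in> topspace X"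
  shows "dense_orbit T X act x \<longleftrightarrow>
    (\<forall>U. openin X U \<longrightarrow> U \<noteq> {} \<longrightarrow> (\<exists>t\<in>carrier T. act t x \<in> U))"
proof -
  have "orbit_of T act x \<subseteq> topspace X"
    using assms act_closed by (auto simp: orbit_of_def)
  then show ?thesis
    unfolding dense_orbit_def dense_intersects_open orbit_of_def by blast
qed

end

text \<open>\<open>\<R>\<close> is an open subbase of an invariant uniformity on \<open>X\<close>:
  finite intersections are formed where required, and distinct points may stay unseparated. As its
  members are open and contain the diagonal, this uniformity is coarser than that of
  \<open>X\<close>.\<close>

locale invariant_entourages = group_flow T \<tau> X act
  for T :: "('g, 'm) monoid_scheme" (structure)
    and \<tau> :: "'g topology" and X :: "'x topology" and act :: "'g \<Rightarrow> 'x \<Rightarrow> 'x" +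
  fixes \<R> :: "('x \<times> 'x) set set"
  assumes open_R: "R \<in> \<R> \<Longrightarrow> openin (prod_topology X X) R"
    and refl_R: "\<lbrakk>R \<in> \<R>; x \<in> topspace X\<rbrakk> \<Longrightarrow> (x, x) \<in> R"
    and inv_R: "\<lbrakk>R \<in> \<R>; t \<in> carrier T; (x, y) \<in> R\<rbrakk> \<Longrightarrow> (act t x, act t y) \<in> R"
    and sym_R: "R \<in> \<R> \<Longrightarrow> \<exists>Q\<in>\<R>. Q\<inverse> \<subseteq> R"
    and comp_R: "R \<in> \<R> \<Longrightarrow> \<exists>Q\<in>\<R>. Q O Q \<subseteq> R"
begin

section \<open>Quotient by the intersection of the entourages\<close>

definition S :: "('x \<times> 'x) set" where
  "S = {(x, y). x \<in> topspace X \<and> y \<in> topspace X \<and> (\<forall>R\<in>\<R>. (x, y) \<in> R)}"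

definition \<pi> :: "'x \<Rightarrow> 'x set" where
  "\<pi> x = S `` {x}"

definition Y :: "'x set topology" where
  "Y = topology (\<lambda>A. A \<subseteq> \<pi> ` topspace X \<and> openin X {x \<in> topspace X. \<pi> x \<in> A})"

definition actY :: "'g \<Rightarrow> 'x set \<Rightarrow> 'x set" where
  "actY t A = act t ` A"

lemma R_subset: "R \<in> \<R> \<Longrightarrow> R \<subseteq> topspace X \<times> topspace X"
  using openin_subset[OF open_R] by simp

lemma equiv_S: "equiv (topspace X) S"
proof (rule equivI)
  show "S \<subseteq> topspace X \<times> topspace X" by (auto simp: S_def)
  show "refl_on (topspace X) S"
    using refl_R by (auto simp: S_def refl_on_def)
  show "sym S"
    unfolding sym_def S_def using sym_R by blast
  show "trans S"
  proof (rule transI)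
    fix x y z assume xy: "(x, y) \<in> S" and yz: "(y, z) \<in> S"
    have "(x, z) \<in> R" if R: "R \<in> \<R>" for R
    proof -
      obtain Q where "Q \<in> \<R>" "Q O Q \<subseteq> R" using comp_R[OF R] by blast
      then show ?thesis using xy yz by (auto simp: S_def)
    qed
    then show "(x, z) \<in> S" using xy yz by (simp add: S_def)
  qed
qed

lemma \<pi>_eq_iff: "\<lbrakk>x \<in> topspace X; y \<in> topspace X\<rbrakk> \<Longrightarrow> \<pi> x = \<pi> y \<longleftrightarrow> (\<forall>R\<in>\<R>. (x, y) \<in> R)"
  unfolding \<pi>_def using eq_equiv_class_iff[OF equiv_S] by (auto simp: S_def)

text \<open>Openness at the diagonal point \<open>(x, x)\<close>, with both sides shrunk to one
  \<open>N\<close>, so that \<open>x\<close> and any other point of \<open>N\<close> are related in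
  both orders.\<close>

lemma slice_nhd:
  assumes R: "R \<in> \<R>" and x: "x \<in> topspace X"
  obtains N where "openin X N" "x \<in> N" "N \<times> N \<subseteq> R"
proof -
  obtain A B where "openin X A" "openin X B" "x \<in> A" "x \<in> B" "A \<times> B \<subseteq> R"
    using openin_prod_topology_alt[THEN iffD1, rule_format, OF open_R[OF R] refl_R[OF R x]] by metis
  then show thesis
    by (intro that[of "A \<inter> B"]) auto
qed

text \<open>A pair in the closure of \<open>Q\<close> is joined by three \<open>Q\<close>-steps,
  from \<open>x\<close> to \<open>x'\<close> to \<open>y'\<close> to \<open>y\<close>, where
  \<open>(x', y') \<in> Q\<close> lies near it. Hence \<open>Q\<close> is chosen with its fourfold
  composite inside \<open>R\<close>. The compactness arguments below use these closures.\<close>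

lemma closure_R:
  assumes "R \<in> \<R>"
  shows "\<exists>Q\<in>\<R>. prod_topology X X closure_of Q \<subseteq> R"
proof -
  obtain P where P: "P \<in> \<R>" "P O P \<subseteq> R" using comp_R assms by blast
  obtain Q where Q: "Q \<in> \<R>" "Q O Q \<subseteq> P" using comp_R P by blast
  have QP: "Q \<subseteq> P" using Q refl_R R_subset by blast
  have "(x, y) \<in> R" if cl: "(x, y) \<in> prod_topology X X closure_of Q" for x y
  proof -
    have xy: "x \<in> topspace X" "y \<in> topspace X"
      using cl by (auto simp: in_closure_of)
    obtain N where N: "openin X N" "x \<in> N" "N \<times> N \<subseteq> Q" using slice_nhd Q xy by metis
    obtain M where M: "openin X M" "y \<in> M" "M \<times> M \<subseteq> Q" using slice_nhd Q xy by metis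
    have "openin (prod_topology X X) (N \<times> M)" "(x, y) \<in> N \<times> M"
      using N M by (auto simp: openin_prod_Times_iff)
    then obtain p where "p \<in> Q" "p \<in> N \<times> M"
      using cl unfolding in_closure_of by metis
    then obtain x' y' where "(x', y') \<in> Q" "x' \<in> N" "y' \<in> M"
      by (cases p) auto
    then have "(x, x') \<in> Q" "(x', y') \<in> Q" "(y', y) \<in> Q" using N M by auto
    then show ?thesis using P Q QP by blast
  qed
  then have "prod_topology X X closure_of Q \<subseteq> R" by (rule subrelI)
  then show ?thesis using Q(1) by (rule bexI)
qed

lemma closedin_S: "closedin (prod_topology X X) S"
proof -
  \<comment> \<open>The full square keeps the intersection inside the space when \<open>\<R>\<close>
    is empty.\<close>
  let ?C = "insert (topspace X \<times> topspace X) ((\<lambda>R. prod_topology X X closure_of R) ` \<R>)"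
  have "S = \<Inter>?C"
  proof
    have "S \<subseteq> prod_topology X X closure_of R" if "R \<in> \<R>" for R
    proof -
      have "S \<subseteq> R" using that by (auto simp: S_def)
      also have "R \<subseteq> prod_topology X X closure_of R"
        using R_subset[OF that] by (simp add: closure_of_subset)
      finally show ?thesis .
    qed
    then show "S \<subseteq> \<Inter>?C" by (auto simp: S_def)
    show "\<Inter>?C \<subseteq> S"
    proof
      fix p assume p: "p \<in> \<Inter>?C"
      have "p \<in> R" if "R \<in> \<R>" for R
        using closure_R[OF that] p by blast
      moreover have "p \<in> topspace X \<times> topspace X" using p by blast
      ultimately show "p \<in> S" by (auto simp: S_def)
    qed
  qed
  moreover have "closedin (prod_topology X X) (\<Inter>?C)"
    by (rule closedin_Inter) (auto simp flip: topspace_prod_topology)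
  ultimately show ?thesis by simp
qed

section \<open>The quotient topology and its separation\<close>

lemma openin_Y: "openin Y A \<longleftrightarrow> A \<subseteq> \<pi> ` topspace X \<and> openin X {x \<in> topspace X. \<pi> x \<in> A}"
proof -
  have "istopology (\<lambda>A. A \<subseteq> \<pi> ` topspace X \<and> openin X {x \<in> topspace X. \<pi> x \<in> A})"
    unfolding istopology_def
  proof (intro conjI allI impI; (elim conjE)?)
    fix A B assume "openin X {x \<in> topspace X. \<pi> x \<in> A}" "openin X {x \<in> topspace X. \<pi> x \<in> B}"
    then have "openin X ({x \<in> topspace X. \<pi> x \<in> A} \<inter> {x \<in> topspace X. \<pi> x \<in> B})" by blast
    then show "openin X {x \<in> topspace X. \<pi> x \<in> A \<inter> B}"
      by (rule back_subst[of "openin X"]) auto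
  next
    fix K assume "\<forall>A\<in>K. A \<subseteq> \<pi> ` topspace X \<and> openin X {x \<in> topspace X. \<pi> x \<in> A}"
    then have "openin X (\<Union>A\<in>K. {x \<in> topspace X. \<pi> x \<in> A})" by blast
    then show "openin X {x \<in> topspace X. \<pi> x \<in> \<Union>K}"
      by (rule back_subst[of "openin X"]) auto
  qed auto
  then show ?thesis by (simp add: Y_def topology_inverse')
qed

lemma topspace_Y: "topspace Y = \<pi> ` topspace X"
proof -
  have "{x \<in> topspace X. \<pi> x \<in> \<pi> ` topspace X} = topspace X" by blast
  then have "openin Y (\<pi> ` topspace X)" by (simp add: openin_Y)
  then show ?thesis
    using openin_subset[of Y] openin_Y openin_topspace[of Y] by blast
qed

lemma quotient_map_\<pi>: "quotient_map X Y \<pi>"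
  unfolding quotient_map_def by (auto simp: topspace_Y openin_Y)

lemma continuous_map_\<pi>: "continuous_map X Y \<pi>"
  using quotient_map_\<pi> by (rule quotient_imp_continuous_map)

text \<open>The saturation of a closed set \<open>C\<close> is the projection of the closed set
  \<open>S \<inter> C \<times> topspace X\<close> to the second coordinate, and projecting along the
  compact factor \<open>X\<close> is a closed map.\<close>

lemma closed_map_\<pi>: "closed_map X Y \<pi>"
  unfolding closed_map_def
proof (intro allI impI)
  fix C assume C: "closedin X C"
  have "closedin (prod_topology X X) (S \<inter> C \<times> topspace X)"
    using C closedin_S by (intro closedin_Int) (auto simp: closedin_prod_Times_iff)
  then have "closedin X (snd ` (S \<inter> C \<times> topspace X))"
    using Abstract_Topological_Spaces.closed_map_snd[OF compact, of X] by (simp add: closed_map_def)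
  moreover have "snd ` (S \<inter> C \<times> topspace X) = {x \<in> topspace X. \<pi> x \<in> \<pi> ` C}"
  proof -
    have S_iff: "(c, x) \<in> S \<longleftrightarrow> \<pi> x = \<pi> c" if "c \<in> C" "x \<in> topspace X" for c x
      using that eq_equiv_class_iff[OF equiv_S, of c x] closedin_subset[OF C]
      unfolding \<pi>_def by blast
    show ?thesis
    proof (intro equalityI subsetI)
      fix x assume "x \<in> snd ` (S \<inter> C \<times> topspace X)"
      then show "x \<in> {x \<in> topspace X. \<pi> x \<in> \<pi> ` C}" using S_iff by auto
    next
      fix x assume "x \<in> {x \<in> topspace X. \<pi> x \<in> \<pi> ` C}"
      then obtain c where "c \<in> C" "\<pi> x = \<pi> c" "x \<in> topspace X" by blast
      then have "(c, x) \<in> S \<inter> C \<times> topspace X" using S_iff by blast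
      then show "x \<in> snd ` (S \<inter> C \<times> topspace X)" by force
    qed
  qed
  ultimately have "closedin X {x \<in> topspace X. \<pi> x \<in> \<pi> ` C}" by (rule back_subst)
  moreover have "\<pi> ` C \<subseteq> topspace Y"
    using closedin_subset[OF C] by (auto simp: topspace_Y)
  ultimately show "closedin Y (\<pi> ` C)"
    using quotient_map_\<pi>[unfolded quotient_map_closedin] by blast
qed

lemma compact_Y: "compact_space Y"
  using image_compactin[of X "topspace X" Y \<pi>] compact continuous_map_\<pi>
  by (simp add: compact_space_def topspace_Y)

text \<open>A closed continuous image of the normal space \<open>X\<close> is normal, and points of
  \<open>Y\<close> are closed as images of closed singletons.\<close>

lemma Hausdorff_Y: "Hausdorff_space Y"
proof -
  have "normal_space Y"
    by (rule normal_space_continuous_closed_map_image[OF _ continuous_map_\<pi> closed_map_\<pi> topspace_Y[symmetric]])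
      (use compact_Hausdorff_or_regular_imp_normal_space compact Hausdorff in blast)
  moreover have "t1_space Y"
    unfolding t1_space_closedin_singleton
  proof
    fix y assume "y \<in> topspace Y"
    then obtain x where "x \<in> topspace X" "y = \<pi> x" by (auto simp: topspace_Y)
    then show "closedin Y {y}"
      using closed_map_\<pi>[unfolded closed_map_def, rule_format, of "{x}"]
      by (simp add: closedin_Hausdorff_singleton Hausdorff)
  qed
  ultimately show ?thesis using normal_t1_imp_Hausdorff_space by blast
qed

section \<open>The induced action\<close>

lemma actY_\<pi>: "\<lbrakk>t \<in> carrier T; x \<in> topspace X\<rbrakk> \<Longrightarrow> actY t (\<pi> x) = \<pi> (act t x)"
proof (intro equalityI subsetI)
  fix z assume t: "t \<in> carrier T" and x: "x \<in> topspace X"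
  { assume "z \<in> actY t (\<pi> x)"
    then show "z \<in> \<pi> (act t x)"
      using t x inv_R act_closed by (auto simp: actY_def \<pi>_def S_def) }
  \<comment> \<open>Every point of the target class comes from the source class: pull it back by
    \<open>inv t\<close>, which preserves the entourages too.\<close>
  { assume "z \<in> \<pi> (act t x)"
    then have z: "z \<in> topspace X" "\<forall>R\<in>\<R>. (act t x, z) \<in> R" by (auto simp: \<pi>_def S_def)
    then have "\<forall>R\<in>\<R>. (x, act (inv t) z) \<in> R"
      using inv_R[of _ "inv t" "act t x" z] t x by (simp add: act_inv_act)
    then have "act (inv t) z \<in> \<pi> x" using z t x act_closed by (auto simp: \<pi>_def S_def)
    then show "z \<in> actY t (\<pi> x)"
      unfolding actY_def using act_act_inv[OF t z(1)] by (metis imageI) }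
qed

text \<open>A product of a quotient map with an identity need not be a quotient map. Here
  \<open>\<pi>\<close> is proper, being continuous from a compact to a Hausdorff space, so its
  product with the identity of the phase group is proper, hence closed and a quotient map.
  Continuity then descends from the action on \<open>X\<close>.\<close>

lemma continuous_actY: "continuous_map (prod_topology \<tau> Y) Y (\<lambda>(t, y). actY t y)"
proof -
  have "proper_map X Y \<pi>"
    using continuous_imp_proper_map compact Hausdorff_Y Hausdorff_imp_kc_space continuous_map_\<pi> by blast
  then have "proper_map (prod_topology \<tau> X) (prod_topology \<tau> Y) (\<lambda>(t, x). (t, \<pi> x))"
    using proper_map_prod[of \<tau> X \<tau> Y id \<pi>] by simp
  then have closed: "closed_map (prod_topology \<tau> X) (prod_topology \<tau> Y) (\<lambda>(t, x). (t, \<pi> x))"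
    by (rule proper_imp_closed_map)
  have "continuous_map (prod_topology \<tau> X) (prod_topology \<tau> Y) (\<lambda>(t, x). (t, \<pi> x))"
    using continuous_map_prod_top[of \<tau> X \<tau> Y "\<lambda>t. t" \<pi>] continuous_map_\<pi> by simp
  moreover have "(\<lambda>(t, x). (t, \<pi> x)) ` topspace (prod_topology \<tau> X) = topspace (prod_topology \<tau> Y)"
    by (auto simp: topspace_Y)
  ultimately have quot: "quotient_map (prod_topology \<tau> X) (prod_topology \<tau> Y) (\<lambda>(t, x). (t, \<pi> x))"
    using closed continuous_closed_imp_quotient_map by blast
  have "continuous_map (prod_topology \<tau> X) Y (\<pi> \<circ> (\<lambda>(t, x). act t x))"
    using continuous_action continuous_map_\<pi> by (rule continuous_map_compose)
  then have "continuous_map (prod_topology \<tau> X) Y ((\<lambda>(t, y). actY t y) \<circ> (\<lambda>(t, x). (t, \<pi> x)))"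
    by (rule continuous_map_eq) (auto simp: actY_\<pi> topspace_group)
  then show ?thesis by (rule continuous_compose_quotient_map[OF quot])
qed

lemma flow_Y: "flow T \<tau> Y actY"
proof -
  have "topological_semigroup T \<tau>"
    using flow by (simp add: flow_def semiflow_def)
  moreover have "actY \<one> y = y" if "y \<in> topspace Y" for y
    using that by (auto simp: topspace_Y actY_\<pi> act_one)
  moreover have "actY t (actY s y) = actY (t \<otimes> s) y"
    if "y \<in> topspace Y" "s \<in> carrier T" "t \<in> carrier T" for s t y
    using that by (auto simp: topspace_Y actY_\<pi> act_act act_closed)
  ultimately show ?thesis
    using nonempty compact_Y Hausdorff_Y continuous_actY is_group
    by (simp add: flow_def semiflow_def topspace_Y)
qed

section \<open>Factor map, equicontinuity, minimality and singleton fibres\<close>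

lemma epimorphism_\<pi>: "epimorphism T X act Y actY \<pi>"
  unfolding epimorphism_def by (simp add: continuous_map_\<pi> topspace_Y actY_\<pi>)

text \<open>By compactness, finitely many members of \<open>\<R>\<close> already force the images of
  a pair into \<open>W\<close>. Their intersection \<open>E\<close> is invariant, so pairs of
  classes with representatives in \<open>E\<close> stay in \<open>W\<close> under the whole group.
  The resulting \<open>\<delta>\<close> does not depend on \<open>y\<close>.\<close>

lemma equicontinuous_Y: "equicontinuous_semiflow T \<tau> Y actY"
  unfolding equicontinuous_semiflow_def entourages_eq_diagonal_nhds[OF compact_Y Hausdorff_Y]
proof (intro conjI ballI)
  let ?XX = "prod_topology X X" and ?YY = "prod_topology Y Y" and ?p = "\<lambda>(x, x'). (\<pi> x, \<pi> x')"
  show "semiflow T \<tau> Y actY" using flow_Y by (simp add: flow_def)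
  fix y \<epsilon> assume "y \<in> topspace Y" and "\<epsilon> \<in> diagonal_nhds Y"
  then obtain W where W: "openin ?YY W" "Id_on (topspace Y) \<subseteq> W" "W \<subseteq> \<epsilon>"
    unfolding diagonal_nhds_def by blast
  have contp: "continuous_map ?XX ?YY ?p"
    using continuous_map_prod_top[of X X Y Y \<pi> \<pi>] continuous_map_\<pi> by simp
  define P where "P = {p \<in> topspace ?XX. ?p p \<in> W}"
  have P: "openin ?XX P"
    unfolding P_def using contp W(1) by (rule openin_continuous_map_preimage)
  have compK: "compactin ?XX (topspace ?XX - P)"
    using P compact by (intro closedin_compact_space closedin_diff closedin_topspace)
      (simp_all add: compact_space_prod_topology)
  \<comment> \<open>A pair outside \<open>P\<close> has two different classes, so some
    \<open>R\<close> omits it; an entourage with closure inside that \<open>R\<close> gives an open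
    set around the pair.\<close>
  have cover: "topspace ?XX - P \<subseteq> (\<Union>R\<in>\<R>. topspace ?XX - ?XX closure_of R)"
  proof
    fix p assume p: "p \<in> topspace ?XX - P"
    then obtain x x' where xx: "p = (x, x')" "x \<in> topspace X" "x' \<in> topspace X" "(\<pi> x, \<pi> x') \<notin> W"
      by (auto simp: P_def)
    then have "(\<pi> x, \<pi> x) \<in> W" using W(2) by (auto simp: topspace_Y Id_on_def)
    then have "\<pi> x \<noteq> \<pi> x'" using xx(4) by metis
    then obtain R where "R \<in> \<R>" "(x, x') \<notin> R" using \<pi>_eq_iff xx by blast
    then show "p \<in> (\<Union>R\<in>\<R>. topspace ?XX - ?XX closure_of R)"
      using closure_R xx by fastforce
  qed
  have "\<exists>\<G>. finite \<G> \<and> \<G> \<subseteq> (\<lambda>R. topspace ?XX - ?XX closure_of R) ` \<R> \<and> topspace ?XX - P \<subseteq> \<Union>\<G>"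
    by (rule compactinD[OF compK _ cover]) (auto intro!: openin_diff simp flip: topspace_prod_topology)
  then obtain \<G> where \<G>: "finite \<G>" "\<G> \<subseteq> (\<lambda>R. topspace ?XX - ?XX closure_of R) ` \<R>"
    "topspace ?XX - P \<subseteq> \<Union>\<G>" by blast
  obtain \<F> where \<F>: "\<F> \<subseteq> \<R>" "finite \<F>" "\<G> = (\<lambda>R. topspace ?XX - ?XX closure_of R) ` \<F>"
    using finite_subset_image[OF \<G>(1,2)] by blast
  note sub = \<G>(3)[unfolded \<F>(3)]
  have \<F>P: "(x, x') \<in> P" if xx: "x \<in> topspace X" "x' \<in> topspace X" "\<forall>R\<in>\<F>. (x, x') \<in> R" for x x'
  proof (rule ccontr)
    assume "(x, x') \<notin> P"
    then obtain R where R: "R \<in> \<F>" "(x, x') \<notin> ?XX closure_of R" using sub xx(1,2) by auto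
    then have "R \<subseteq> ?XX closure_of R"
      using closure_of_subset[of R ?XX] R_subset \<F>(1) by auto
    then show False using R xx(3) by blast
  qed
  define E where "E = topspace ?XX \<inter> \<Inter>\<F>"
  have E_eq: "E = \<Inter>(insert (topspace ?XX) \<F>)" by (simp add: E_def)
  have "openin ?XX E"
    unfolding E_eq using \<F>(1,2) open_R
    by (intro openin_Inter) (auto simp flip: topspace_prod_topology)
  then have "closedin ?XX (topspace ?XX - E)"
    by blast
  moreover have "closed_map ?XX ?YY ?p"
    using contp compact Hausdorff_Y
    by (intro continuous_imp_closed_map_gen) (auto simp: compact_space_prod_topology Hausdorff_space_prod_topology Hausdorff_imp_kc_space)
  ultimately have closed: "closedin ?YY (?p ` (topspace ?XX - E))"
    unfolding closed_map_def by blast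
  \<comment> \<open>\<open>E\<close> need not be saturated. The complement of the image of its
    complement is open and consists of the pairs all of whose representatives lie in
    \<open>E\<close>.\<close>
  define \<delta> where "\<delta> = topspace ?YY - ?p ` (topspace ?XX - E)"
  have op: "openin ?YY \<delta>"
    unfolding \<delta>_def using closed by (intro openin_diff openin_topspace)
  have diag: "Id_on (topspace Y) \<subseteq> \<delta>"
  proof -
    have "(x, x') \<in> E" if "\<pi> x = \<pi> x'" "x \<in> topspace X" "x' \<in> topspace X" for x x'
      using that \<pi>_eq_iff \<F>(1) by (auto simp: E_def)
    then show ?thesis by (force simp: \<delta>_def)
  qed
  have "\<delta> \<in> diagonal_nhds Y"
    using op diag openin_subset[OF op] by (auto simp: diagonal_nhds_def)
  moreover have "(actY t y, actY t y') \<in> \<epsilon>" if yy: "(y, y') \<in> \<delta>" and t: "t \<in> carrier T" for y' t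
  proof -
    have "y \<in> topspace Y" "y' \<in> topspace Y" using yy by (auto simp: \<delta>_def)
    then obtain x x' where x: "x \<in> topspace X" "x' \<in> topspace X" "y = \<pi> x" "y' = \<pi> x'"
      by (auto simp: topspace_Y)
    have "(x, x') \<in> E"
    proof (rule ccontr)
      assume "(x, x') \<notin> E"
      then have "?p (x, x') \<in> ?p ` (topspace ?XX - E)" using x by (intro imageI) simp
      then show False using yy x by (simp add: \<delta>_def)
    qed
    then have "\<forall>R\<in>\<F>. (act t x, act t x') \<in> R" using inv_R \<F>(1) t by (auto simp: E_def)
    then have "(act t x, act t x') \<in> P" using \<F>P x t act_closed by blast
    then show ?thesis using W(3) x t by (auto simp: P_def actY_\<pi>)
  qed
  ultimately show "\<exists>\<delta>\<in>diagonal_nhds Y. \<forall>y'. (y, y') \<in> \<delta> \<longrightarrow> (\<forall>t\<in>carrier T. (actY t y, actY t y') \<in> \<epsilon>)"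
    by blast
qed

lemma minimal_Y:
  assumes "minimal_semiflow T \<tau> X act"
  shows "minimal_semiflow T \<tau> Y actY"
  unfolding minimal_semiflow_def
proof (intro conjI ballI)
  interpret Y: group_flow T \<tau> Y actY using flow_Y by unfold_locales
  show "semiflow T \<tau> Y actY" using flow_Y by (simp add: flow_def)
  fix y assume y: "y \<in> topspace Y"
  then obtain x where x: "x \<in> topspace X" "y = \<pi> x" by (auto simp: topspace_Y)
  then have dense: "dense_orbit T X act x" using assms by (simp add: minimal_semiflow_def)
  show "dense_orbit T Y actY y"
    unfolding Y.dense_orbit_iff[OF y]
  proof (intro allI impI)
    fix U assume U: "openin Y U" "U \<noteq> {}"
    then have "openin X {x \<in> topspace X. \<pi> x \<in> U}" "{x \<in> topspace X. \<pi> x \<in> U} \<noteq> {}"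
      using openin_Y by auto
    then obtain t where "t \<in> carrier T" "\<pi> (act t x) \<in> U"
      using dense dense_orbit_iff[OF x(1)] by blast
    then show "\<exists>t\<in>carrier T. actY t y \<in> U" using x actY_\<pi> by auto
  qed
qed

text \<open>When \<open>act (t n) x\<close> and \<open>y = act (t n) (x' n)\<close> are
  \<open>Q\<close>-close, invariance under \<open>inv (t n)\<close> makes \<open>x\<close> and
  \<open>x' n\<close> \<open>Q\<close>-close. In the limit \<open>x\<close> and \<open>z\<close> lie
  in a common class, and the fibre is a singleton.\<close>

lemma aa_point_if_singleton_fibre:
  assumes x: "x \<in> topspace X" and fib: "fibre X \<pi> (\<pi> x) = {x}"
  shows "x \<in> aa_points T X act"
  unfolding aa_points_def aa_condition_def
proof (intro CollectI conjI allI impI x, elim conjE)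
  fix D :: "(('g \<times> 'x) set \<times> 'g \<times> 'x) set" and leq t x' y z
  assume D: "directed_index D leq" and t: "t ` D \<subseteq> carrier T" and x': "x' ` D \<subseteq> topspace X"
    and cy: "net_converges X D leq (\<lambda>n. act (t n) x) y" and cz: "net_converges X D leq x' z"
    and eq: "\<forall>n\<in>D. act (t n) (x' n) = y"
  have yz: "y \<in> topspace X" "z \<in> topspace X" using cy cz by (auto simp: net_converges_def)
  have "(x, z) \<in> R" if R: "R \<in> \<R>" for R
  proof -
    obtain Q where Q: "Q \<in> \<R>" "Q O Q \<subseteq> R" using comp_R R by blast
    obtain N where N: "openin X N" "y \<in> N" "N \<times> N \<subseteq> Q" using slice_nhd Q yz by metis
    obtain M where M: "openin X M" "z \<in> M" "M \<times> M \<subseteq> Q" using slice_nhd Q yz by metis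
    obtain i where i: "i \<in> D" "\<forall>n\<in>D. leq i n \<longrightarrow> act (t n) x \<in> N"
      using cy N unfolding net_converges_def by blast
    obtain j where j: "j \<in> D" "\<forall>n\<in>D. leq j n \<longrightarrow> x' n \<in> M"
      using cz M unfolding net_converges_def by blast
    obtain n where n: "n \<in> D" "leq i n" "leq j n"
      using D i j unfolding directed_index_def by blast
    then have tn: "t n \<in> carrier T" "x' n \<in> topspace X" using t x' by auto
    have "(act (t n) x, act (t n) (x' n)) \<in> Q" using i n N eq by auto
    then have "(act (inv (t n)) (act (t n) x), act (inv (t n)) (act (t n) (x' n))) \<in> Q"
      using inv_R Q tn by blast
    then have "(x, x' n) \<in> Q" using tn x by (simp add: act_inv_act)
    moreover have "(x' n, z) \<in> Q" using j n M by auto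
    ultimately show ?thesis using Q by blast
  qed
  then have "\<pi> x = \<pi> z" using \<pi>_eq_iff x yz by blast
  then show "x = z" using fib yz by (auto simp: fibre_def)
qed

end

section \<open>Almost automorphic points\<close>

context group_flow
begin

section \<open>Returns of an almost automorphic point\<close>

lemma aa_points_subset: "aa_points T X act \<subseteq> topspace X"
  by (auto simp: aa_points_def)

text \<open>Compactness turns the net condition into neighbourhoods. If every \<open>N\<close>
  failed, the points \<open>act (inv t) y\<close> outside \<open>U\<close> with
  \<open>act t a \<in> N\<close> would accumulate, as \<open>N\<close> shrinks around
  \<open>y\<close>, at some \<open>x'\<close> outside \<open>U\<close>. Nets with
  \<open>act t a\<close> tending to \<open>y\<close> and \<open>act (inv t) y\<close> to
  \<open>x'\<close> then contradict almost automorphy.\<close>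

lemma aa_point_return:
  assumes a: "a \<in> aa_points T X act" and y: "y \<in> topspace X" and U: "openin X U" "a \<in> U"
  shows "\<exists>N. openin X N \<and> y \<in> N \<and> (\<forall>t\<in>carrier T. act t a \<in> N \<longrightarrow> act (inv t) y \<in> U)"
proof (rule ccontr)
  define B where "B N = {act (inv t) y | t. t \<in> carrier T \<and> act t a \<in> N \<and> act (inv t) y \<notin> U}" for N
  define \<N> where "\<N> = {N. openin X N \<and> y \<in> N}"
  \<comment> \<open>The nets are indexed by pairs of neighbourhoods of \<open>y\<close> and
    \<open>x'\<close>, ordered by reverse inclusion.\<close>
  define D where "D x' = {(N, M). openin X N \<and> y \<in> N \<and> openin X M \<and> x' \<in> M}" for x'
  define leq where "leq p q \<longleftrightarrow> fst q \<subseteq> fst p \<and> snd q \<subseteq> snd p" for p q :: "'x set \<times> 'x set"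
  assume "\<not> ?thesis"
  then have B_ne: "B N \<noteq> {}" if "N \<in> \<N>" for N
    using that by (fastforce simp: B_def \<N>_def)
  have B_sub: "B N \<subseteq> topspace X - U" for N
    using act_closed y by (auto simp: B_def)
  \<comment> \<open>\<open>B\<close> is monotone, so its nonempty value at a finite intersection
    lies in all the closures; the whole space is inserted for the empty family.\<close>
  have fip: "\<Inter>\<F> \<noteq> {}" if \<F>: "finite \<F>" "\<F> \<subseteq> (\<lambda>N. X closure_of B N) ` \<N>" for \<F>
  proof -
    obtain \<G> where \<G>: "finite \<G>" "\<G> \<subseteq> \<N>" "\<F> = (\<lambda>N. X closure_of B N) ` \<G>"
      using \<F> by (meson finite_subset_image)
    have "openin X (\<Inter>(insert (topspace X) \<G>))"
      using \<G> by (intro openin_Inter) (auto simp: \<N>_def)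
    then have N0: "\<Inter>(insert (topspace X) \<G>) \<in> \<N>"
      using \<G> y by (auto simp: \<N>_def)
    have "B (\<Inter>(insert (topspace X) \<G>)) \<subseteq> X closure_of B N" if "N \<in> \<G>" for N
    proof -
      have "B (\<Inter>(insert (topspace X) \<G>)) \<subseteq> B N" using that by (auto simp: B_def)
      also have "B N \<subseteq> X closure_of B N" using B_sub by (intro closure_of_subset) blast
      finally show ?thesis .
    qed
    then have "B (\<Inter>(insert (topspace X) \<G>)) \<subseteq> \<Inter>\<F>" unfolding \<G>(3) by (rule INT_greatest)
    then show ?thesis using B_ne[OF N0] by blast
  qed
  have "\<Inter>((\<lambda>N. X closure_of B N) ` \<N>) \<noteq> {}"
    using compact[unfolded compact_space_fip, rule_format, of "(\<lambda>N. X closure_of B N) ` \<N>"] fip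
    by auto
  then obtain x' where x': "\<And>N. N \<in> \<N> \<Longrightarrow> x' \<in> X closure_of B N" by blast
  have "topspace X \<in> \<N>" using y by (simp add: \<N>_def)
  then have x'cl: "x' \<in> X closure_of B (topspace X)" by (rule x')
  have "X closure_of B (topspace X) \<subseteq> topspace X - U"
    using B_sub U(1) by (intro closure_of_minimal) auto
  then have x'U: "x' \<in> topspace X" "x' \<notin> U" using x'cl by auto
  have "\<exists>t. t \<in> carrier T \<and> act t a \<in> fst p \<and> act (inv t) y \<in> snd p" if "p \<in> D x'" for p
  proof -
    have "fst p \<in> \<N>" "openin X (snd p)" "x' \<in> snd p" using that by (auto simp: D_def \<N>_def)
    then obtain z where "z \<in> B (fst p)" "z \<in> snd p" using x' unfolding in_closure_of by blast
    then show ?thesis by (auto simp: B_def)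
  qed
  then obtain t where t: "\<And>p. p \<in> D x' \<Longrightarrow>
      t p \<in> carrier T \<and> act (t p) a \<in> fst p \<and> act (inv (t p)) y \<in> snd p"
    by metis
  have top: "(topspace X, topspace X) \<in> D x'" using y x'U by (simp add: D_def)
  have dir: "directed_index (D x') leq"
    unfolding directed_index_def
  proof (intro conjI ballI impI)
    show "D x' \<noteq> {}" using top by blast
    fix p q assume "p \<in> D x'" "q \<in> D x'"
    then have "(fst p \<inter> fst q, snd p \<inter> snd q) \<in> D x'" by (auto simp: D_def)
    then show "\<exists>k\<in>D x'. leq p k \<and> leq q k"
      by (rule bexI[rotated]) (auto simp: leq_def)
  qed (auto simp: leq_def)
  have "net_converges X (D x') leq (\<lambda>p. act (t p) a) y"
    unfolding net_converges_def
  proof (intro conjI allI impI y)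
    fix V assume "openin X V \<and> y \<in> V"
    then have "(V, topspace X) \<in> D x'" using x'U by (simp add: D_def)
    then show "\<exists>m\<in>D x'. \<forall>n\<in>D x'. leq m n \<longrightarrow> act (t n) a \<in> V"
      using t by (intro bexI[of _ "(V, topspace X)"]) (auto simp: leq_def)
  qed
  moreover have "net_converges X (D x') leq (\<lambda>p. act (inv (t p)) y) x'"
    unfolding net_converges_def
  proof (intro conjI allI impI x'U)
    fix V assume "openin X V \<and> x' \<in> V"
    then have "(topspace X, V) \<in> D x'" using y by (simp add: D_def)
    then show "\<exists>m\<in>D x'. \<forall>n\<in>D x'. leq m n \<longrightarrow> act (inv (t n)) y \<in> V"
      using t by (intro bexI[of _ "(topspace X, V)"]) (auto simp: leq_def)
  qed
  moreover have "t ` D x' \<subseteq> carrier T" "(\<lambda>p. act (inv (t p)) y) ` D x' \<subseteq> topspace X"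
    using t act_closed y by auto
  moreover have "\<forall>p\<in>D x'. act (t p) (act (inv (t p)) y) = y"
    using t act_act_inv y by blast
  \<comment> \<open>The index type of these nets is not the one fixed in \<open>aa_points\<close>,
    hence the transfer through \<open>aa_points_arbitrary_net\<close>.\<close>
  ultimately have "a = x'"
    using aa_points_arbitrary_net[OF a, of "D x'" leq t "\<lambda>p. act (inv (t p)) y"] dir
    unfolding aa_condition_def by blast
  then show False using x'U U by simp
qed

text \<open>Fix \<open>y\<close> and \<open>U\<close>, and let \<open>act s a \<in> U\<close>.
  Points \<open>act t a\<close> near \<open>y\<close> make \<open>act (inv t) y\<close> so close to
  \<open>a\<close> that \<open>s\<close> carries it into \<open>U\<close>, and such \<open>t\<close>
  exist because \<open>a\<close> has a dense orbit.\<close>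

lemma minimal_if_aa_dense:
  assumes a: "a \<in> aa_points T X act" and dense: "dense_orbit T X act a"
  shows "minimal_semiflow T \<tau> X act"
  unfolding minimal_semiflow_def
proof (intro conjI ballI)
  show "semiflow T \<tau> X act" using flow by (simp add: flow_def)
  have aX: "a \<in> topspace X" using a aa_points_subset by blast
  note dense_a = dense[unfolded dense_orbit_iff[OF aX], rule_format]
  fix y assume y: "y \<in> topspace X"
  show "dense_orbit T X act y"
    unfolding dense_orbit_iff[OF y]
  proof (intro allI impI)
    fix U assume U: "openin X U" "U \<noteq> {}"
    then obtain s where s: "s \<in> carrier T" "act s a \<in> U" using dense_a by blast
    then obtain N where N: "openin X N" "y \<in> N"
        "\<forall>t\<in>carrier T. act t a \<in> N \<longrightarrow> act (inv t) y \<in> {x \<in> topspace X. act s x \<in> U}"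
      using aa_point_return[OF a y openin_act_preimage[OF s(1) U(1)]] aX by auto
    then obtain t where "t \<in> carrier T" "act t a \<in> N" using dense_a by blast
    then have "act (s \<otimes> inv t) y \<in> U" using N s y by (auto simp: act_act)
    then show "\<exists>t\<in>carrier T. act t y \<in> U" using s \<open>t \<in> carrier T\<close> by blast
  qed
qed

text \<open>Let \<open>y\<close> be a cluster point of the \<open>act (r j) a\<close>. Some
  \<open>act (r i) a\<close> near \<open>y\<close> gives \<open>act (inv (r i)) y \<in> U\<close> by
  \<open>aa_point_return\<close>, and continuity replaces \<open>y\<close> by a later
  \<open>act (r j) a\<close>.\<close>

lemma aa_point_sequence:
  fixes r :: "nat \<Rightarrow> 'g"
  assumes a: "a \<in> aa_points T X act" and U: "openin X U" "a \<in> U" and r: "\<And>n. r n \<in> carrier T"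
  shows "\<exists>i j. i < j \<and> act (inv (r i) \<otimes> r j) a \<in> U"
proof -
  have aX: "a \<in> topspace X" using a aa_points_subset by blast
  define C where "C n = X closure_of ((\<lambda>j. act (r j) a) ` {n..})" for n
  have "(\<lambda>j. act (r j) a) ` {n..} \<subseteq> C n" for n
    unfolding C_def using act_closed aX r by (intro closure_of_subset) auto
  then have "C n \<noteq> {}" for n by fastforce
  moreover have "decseq C"
    unfolding C_def decseq_def by (intro allI impI closure_of_mono image_mono) auto
  ultimately obtain y where y: "\<And>n. y \<in> C n"
    using compact_space_imp_nest[OF compact, of C] by (auto simp: C_def)
  then have yX: "y \<in> topspace X" by (auto simp: C_def in_closure_of)
  have cluster: "\<exists>j\<ge>n. act (r j) a \<in> N" if "openin X N" "y \<in> N" for n N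
    using y[of n] that by (auto simp: C_def in_closure_of)
  obtain N where N: "openin X N" "y \<in> N" "\<forall>t\<in>carrier T. act t a \<in> N \<longrightarrow> act (inv t) y \<in> U"
    using aa_point_return[OF a yX U] by blast
  obtain i where i: "act (r i) a \<in> N" using cluster[OF N(1,2)] by blast
  let ?M = "{x \<in> topspace X. act (inv (r i)) x \<in> U}"
  have "openin X ?M" "y \<in> ?M"
    using openin_act_preimage U(1) r N i yX by auto
  \<comment> \<open>Clustering in the tail from \<open>Suc i\<close> on makes \<open>j\<close>
    strictly larger than \<open>i\<close>.\<close>
  then obtain j where "j \<ge> Suc i" "act (r j) a \<in> ?M" using cluster by blast
  then show ?thesis
    using r aX by (intro exI[of _ i] exI[of _ j]) (simp add: act_act)
qed

text \<open>If the conclusion fails, choose \<open>s\<^sub>k, t\<^sub>k\<close> returning \<open>a\<close> ever closer to itself with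
  \<open>s\<^sub>k\<inverse> t\<^sub>k a\<close> away from \<open>a\<close>. For \<open>r\<^sub>k = t\<^sub>1 \<cdots> t\<^sub>k\<^sub>-\<^sub>1 s\<^sub>k\<close> the product
  \<open>r\<^sub>i\<inverse> r\<^sub>j = s\<^sub>i\<inverse> t\<^sub>i (t\<^sub>i\<^sub>+\<^sub>1 \<cdots> t\<^sub>j\<^sub>-\<^sub>1 s\<^sub>j)\<close> also moves \<open>a\<close> away, as the bracket was chosen after
  \<open>s\<^sub>i, t\<^sub>i\<close> to move \<open>a\<close> very little. A state below consists of \<open>t\<^sub>1 \<cdots> t\<^sub>k\<^sub>-\<^sub>1\<close> and the set of
  the \<open>r\<^sub>i\<close> with \<open>i < k\<close>.\<close>

lemma aa_point_division:
  assumes a: "a \<in> aa_points T X act" and U: "openin X U" "a \<in> U"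
  shows "\<exists>V. openin X V \<and> a \<in> V \<and>
    (\<forall>s\<in>carrier T. \<forall>t\<in>carrier T. act s a \<in> V \<longrightarrow> act t a \<in> V \<longrightarrow> act (inv s \<otimes> t) a \<in> U)"
proof (rule ccontr)
  have aX: "a \<in> topspace X" using a aa_points_subset by blast
  assume contra: "\<not> ?thesis"
  have bad: "\<exists>s\<in>carrier T. \<exists>t\<in>carrier T. act s a \<in> V \<and> act t a \<in> V \<and> act (inv s \<otimes> t) a \<notin> U"
    if "openin X V" "a \<in> V" for V
    using contra that by blast
  have "neighbourhood_base_of (closedin X) X"
    using compact Hausdorff compact_Hausdorff_imp_regular_space neighbourhood_base_of_closedin by blast
  \<comment> \<open>A closed \<open>C\<close> between \<open>W\<close> and \<open>U\<close> makes
    landing outside \<open>C\<close> an open condition; \<open>W\<close> is the neighbourhood to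
    which \<open>aa_point_sequence\<close> is applied at the end.\<close>
  then obtain W C where OC: "openin X W" "closedin X C" "a \<in> W" "W \<subseteq> C" "C \<subseteq> U"
    using U unfolding neighbourhood_base_of by meson
  \<comment> \<open>The condition on \<open>L\<close> prepares the next step:
    \<open>inv l \<otimes> c\<close> sends \<open>a\<close>, hence all points near \<open>a\<close>,
    outside \<open>C\<close>.\<close>
  define P where "P = (\<lambda>(c, L). c \<in> carrier T \<and> finite L \<and> L \<subseteq> carrier T \<and>
    (\<forall>l\<in>L. act (inv l \<otimes> c) a \<notin> C))"
  define Q where "Q = (\<lambda>(c :: 'g, L) (c' :: 'g, L'). \<exists>r\<in>carrier T. L' = insert r L \<and>
    (\<forall>l\<in>L. act (inv l \<otimes> r) a \<notin> C))"
  have step: "\<exists>p'. P p' \<and> Q p p'" if "P p" for p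
  proof -
    obtain c L where p: "p = (c, L)" by (cases p)
    have c: "c \<in> carrier T" and L: "finite L" "L \<subseteq> carrier T" "\<forall>l\<in>L. act (inv l \<otimes> c) a \<notin> C"
      using that by (auto simp: P_def p)
    define N where "N l = {x \<in> topspace X. act (inv l \<otimes> c) x \<in> topspace X - C}" for l
    have N: "openin X (N l) \<and> a \<in> N l" if "l \<in> L" for l
    proof
      have l: "l \<in> carrier T" using that L(2) by blast
      show "openin X (N l)"
        unfolding N_def using OC(2) l c by (intro openin_act_preimage) auto
      show "a \<in> N l"
        using that L(3) l c aX act_closed by (simp add: N_def)
    qed
    then have "openin X (\<Inter>(insert (topspace X) (N ` L)))"
      using L(1) by (intro openin_Inter) auto
    moreover have "a \<in> \<Inter>(insert (topspace X) (N ` L))"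
      using N aX by blast
    ultimately have "\<exists>s\<in>carrier T. \<exists>t\<in>carrier T. act s a \<in> \<Inter>(insert (topspace X) (N ` L)) \<and>
        act t a \<in> \<Inter>(insert (topspace X) (N ` L)) \<and> act (inv s \<otimes> t) a \<notin> U"
      by (rule bad)
    then obtain s t where st: "s \<in> carrier T" "t \<in> carrier T"
      "\<And>l. l \<in> L \<Longrightarrow> act s a \<in> N l" "\<And>l. l \<in> L \<Longrightarrow> act t a \<in> N l" "act (inv s \<otimes> t) a \<notin> U"
      by auto
    \<comment> \<open>The factor \<open>s\<close> yields the new term \<open>c \<otimes> s\<close>
      of the sequence, and \<open>t\<close> extends the common prefix to
      \<open>c \<otimes> t\<close>.\<close>
    have "act (inv l \<otimes> (c \<otimes> s)) a \<notin> C" "act (inv l \<otimes> (c \<otimes> t)) a \<notin> C" if "l \<in> L" for l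
      using st(3,4)[OF that] st(1,2) that c L(2) aX by (auto simp: N_def act_act m_assoc)
    \<comment> \<open>For the newly stored \<open>c \<otimes> s\<close> the prefix cancels, and the
      condition reduces to the choice of \<open>s\<close> and \<open>t\<close>.\<close>
    moreover have "inv (c \<otimes> s) \<otimes> (c \<otimes> t) = inv s \<otimes> t"
      using c st by (simp add: inv_mult_cancel_left)
    ultimately have "P (c \<otimes> t, insert (c \<otimes> s) L)" "Q p (c \<otimes> t, insert (c \<otimes> s) L)"
      using c L st OC(5) by (auto simp: P_def Q_def p)
    then show ?thesis by blast
  qed
  have "P (\<one>, {})" by (simp add: P_def)
  then obtain f where f: "\<And>n. P (f n)" "\<And>n. Q (f n) (f (Suc n))"
    using dependent_nat_choice[of "\<lambda>_. P" "\<lambda>_. Q"] step by metis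
  have "\<exists>r. r \<in> carrier T \<and> snd (f (Suc n)) = insert r (snd (f n)) \<and>
      (\<forall>l\<in>snd (f n). act (inv l \<otimes> r) a \<notin> C)" for n
    using f(2)[of n] by (auto simp: Q_def split: prod.splits)
  then obtain r where r: "\<And>n. r n \<in> carrier T" "\<And>n. snd (f (Suc n)) = insert (r n) (snd (f n))"
      "\<And>n l. l \<in> snd (f n) \<Longrightarrow> act (inv l \<otimes> r n) a \<notin> C"
    by metis
  have "r i \<in> snd (f j)" if "i < j" for i j
    using that by (induction j) (auto simp: r(2) less_Suc_eq)
  then have "act (inv (r i) \<otimes> r j) a \<notin> C" if "i < j" for i j
    using r(3) that by blast
  \<comment> \<open>No pair \<open>i < j\<close> brings \<open>a\<close> back into \<open>C\<close>,
    hence none into \<open>W\<close>.\<close>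
  then show False
    using aa_point_sequence[OF a OC(1,3) r(1)] OC(4) by blast
qed

section \<open>Inverses and products of small returns\<close>

lemma aa_point_inverse:
  assumes a: "a \<in> aa_points T X act" and U: "openin X U" "a \<in> U"
  shows "\<exists>V. openin X V \<and> a \<in> V \<and> (\<forall>s\<in>carrier T. act s a \<in> V \<longrightarrow> act (inv s) a \<in> U)"
  using aa_point_return[OF a _ U, of a] a aa_points_subset by blast

text \<open>Write \<open>s \<otimes> t\<close> as \<open>inv (inv s) \<otimes> t\<close>; then
  \<open>aa_point_division\<close> applies once \<open>inv s\<close> also moves \<open>a\<close>
  little.\<close>

lemma aa_point_product:
  assumes a: "a \<in> aa_points T X act" and U: "openin X U" "a \<in> U"
  shows "\<exists>V. openin X V \<and> a \<in> V \<and>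
    (\<forall>s\<in>carrier T. \<forall>t\<in>carrier T. act s a \<in> V \<longrightarrow> act t a \<in> V \<longrightarrow> act (s \<otimes> t) a \<in> U)"
proof -
  obtain V where V: "openin X V" "a \<in> V"
    "\<forall>s\<in>carrier T. \<forall>t\<in>carrier T. act s a \<in> V \<longrightarrow> act t a \<in> V \<longrightarrow> act (inv s \<otimes> t) a \<in> U"
    using aa_point_division[OF a U] by blast
  obtain W where W: "openin X W" "a \<in> W" "\<forall>s\<in>carrier T. act s a \<in> W \<longrightarrow> act (inv s) a \<in> V"
    using aa_point_inverse[OF a V(1,2)] by blast
  have "act (s \<otimes> t) a \<in> U" if "s \<in> carrier T" "t \<in> carrier T" "act s a \<in> V \<inter> W" "act t a \<in> V \<inter> W" for s t
    using V(3)[rule_format, of "inv s" t] W(3) that by simp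
  then show ?thesis
    using V W by (intro exI[of _ "V \<inter> W"]) auto
qed

section \<open>The invariant uniformity given by almost automorphic points\<close>

text \<open>The relation \<open>t\<inverse> s a \<in> U\<close> on the orbit points \<open>t a\<close>, \<open>s a\<close>, extended to limits of such points.
  Quantifying universally over orbit points near \<open>x\<close> and \<open>y\<close> makes the entourage open.\<close>

definition aa_entourage :: "'x \<Rightarrow> 'x set \<Rightarrow> ('x \<times> 'x) set" where
  "aa_entourage a U = {(x, y). \<exists>N M. openin X N \<and> openin X M \<and> x \<in> N \<and> y \<in> M \<and>
     (\<forall>t\<in>carrier T. \<forall>s\<in>carrier T. act t a \<in> N \<longrightarrow> act s a \<in> M \<longrightarrow> act (inv t \<otimes> s) a \<in> U)}"

text \<open>Every almost automorphic point contributes entourages based at itself, since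
  \<open>aa_entourages_separate\<close> compares \<open>a\<close> with \<open>y\<close> through
  \<open>aa_entourage a U\<close>.\<close>

definition aa_entourages :: "('x \<times> 'x) set set" where
  "aa_entourages = {aa_entourage a U | a U. a \<in> aa_points T X act \<and> openin X U \<and> a \<in> U}"

text \<open>The witnesses \<open>N\<close> and \<open>M\<close> of one pair serve for all pairs in
  \<open>N \<times> M\<close>.\<close>

lemma aa_entourage_open: "openin (prod_topology X X) (aa_entourage a U)"
  unfolding openin_prod_topology_alt aa_entourage_def by blast

text \<open>Translating \<open>N\<close> and \<open>M\<close> by \<open>t\<close> replaces
  \<open>r\<close> and \<open>s\<close> by \<open>inv t \<otimes> r\<close> and
  \<open>inv t \<otimes> s\<close>, whose quotient is again
  \<open>inv r \<otimes> s\<close>.\<close>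

lemma aa_entourage_invariant:
  assumes t: "t \<in> carrier T" and xy: "(x, y) \<in> aa_entourage a U" and a: "a \<in> topspace X"
  shows "(act t x, act t y) \<in> aa_entourage a U"
proof -
  obtain N M where NM: "openin X N" "openin X M" "x \<in> N" "y \<in> M"
    "\<And>r s. \<lbrakk>r \<in> carrier T; s \<in> carrier T; act r a \<in> N; act s a \<in> M\<rbrakk> \<Longrightarrow> act (inv r \<otimes> s) a \<in> U"
    using xy unfolding aa_entourage_def by blast
  let ?N = "{x \<in> topspace X. act (inv t) x \<in> N}" and ?M = "{x \<in> topspace X. act (inv t) x \<in> M}"
  have X: "x \<in> topspace X" "y \<in> topspace X" using NM openin_subset by blast+
  have "act (inv r \<otimes> s) a \<in> U"
    if rs: "r \<in> carrier T" "s \<in> carrier T" "act r a \<in> ?N" "act s a \<in> ?M" for r s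
  proof -
    have "act (inv (inv t \<otimes> r) \<otimes> (inv t \<otimes> s)) a \<in> U"
      using rs t a by (intro NM(5)) (auto simp: act_act)
    moreover have "inv (inv t \<otimes> r) \<otimes> (inv t \<otimes> s) = inv r \<otimes> s"
      using rs t by (simp add: inv_mult_cancel_left)
    ultimately show ?thesis by simp
  qed
  moreover have "openin X ?N" "openin X ?M"
    using NM t openin_act_preimage by auto
  moreover have "act t x \<in> ?N" "act t y \<in> ?M"
    using NM X t act_closed by (auto simp: act_inv_act)
  ultimately show ?thesis unfolding aa_entourage_def by blast
qed

end

text \<open>Reflexivity, symmetry and composition come from the division, inverse and product
  properties of \<open>a\<close>. Minimality carries reflexivity from near \<open>a\<close> to all
  of \<open>X\<close> and supplies the intermediate orbit points for composition.\<close>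

lemma (in group_flow) invariant_entourages_aa:
  assumes min: "minimal_semiflow T \<tau> X act"
  shows "invariant_entourages T \<tau> X act aa_entourages"
proof
  have dense: "\<exists>t\<in>carrier T. act t x \<in> U" if "x \<in> topspace X" "openin X U" "U \<noteq> {}" for x U
    using min that dense_orbit_iff unfolding minimal_semiflow_def by blast
  have aaE: "\<exists>a U. R = aa_entourage a U \<and> a \<in> aa_points T X act \<and> a \<in> topspace X \<and> openin X U \<and> a \<in> U"
    if "R \<in> aa_entourages" for R
    using that aa_points_subset unfolding aa_entourages_def by blast
  fix R assume "R \<in> aa_entourages"
  then obtain a U where R: "R = aa_entourage a U" and a: "a \<in> aa_points T X act"
      and aX: "a \<in> topspace X" and U: "openin X U" "a \<in> U"
    using aaE by blast
  show "openin (prod_topology X X) R" by (simp add: R aa_entourage_open)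
  show "(act t x, act t y) \<in> R" if "t \<in> carrier T" "(x, y) \<in> R" for t x y
    using that aa_entourage_invariant aX by (simp add: R)
  show "(x, x) \<in> R" if x: "x \<in> topspace X" for x
  proof -
    obtain V where V: "openin X V" "a \<in> V"
      "\<forall>s\<in>carrier T. \<forall>t\<in>carrier T. act s a \<in> V \<longrightarrow> act t a \<in> V \<longrightarrow> act (inv s \<otimes> t) a \<in> U"
      using aa_point_division[OF a U] by blast
    \<comment> \<open>In \<open>V\<close> the required condition is that of
      \<open>aa_point_division\<close>; an arbitrary \<open>x\<close> is moved into \<open>V\<close>
      and afterwards moved back by invariance.\<close>
    obtain r where r: "r \<in> carrier T" "act r x \<in> V" using dense[OF x V(1)] V(2) by blast
    have "(act r x, act r x) \<in> aa_entourage a U"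
      using V r unfolding aa_entourage_def by blast
    then have "(act (inv r) (act r x), act (inv r) (act r x)) \<in> R"
      using aa_entourage_invariant aX r by (simp add: R)
    then show ?thesis using r x by (simp add: act_inv_act)
  qed
  show "\<exists>Q\<in>aa_entourages. Q\<inverse> \<subseteq> R"
  proof -
    obtain V where V: "openin X V" "a \<in> V" "\<forall>s\<in>carrier T. act s a \<in> V \<longrightarrow> act (inv s) a \<in> U"
      using aa_point_inverse[OF a U] by blast
    have "(y, x) \<in> aa_entourage a U" if xy: "(x, y) \<in> aa_entourage a V" for x y
    proof -
      obtain N M where NM: "openin X N" "openin X M" "x \<in> N" "y \<in> M"
        "\<And>t s. \<lbrakk>t \<in> carrier T; s \<in> carrier T; act t a \<in> N; act s a \<in> M\<rbrakk> \<Longrightarrow> act (inv t \<otimes> s) a \<in> V"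
        using xy unfolding aa_entourage_def by blast
      have "act (inv s \<otimes> t) a \<in> U"
        if ts: "t \<in> carrier T" "s \<in> carrier T" "act t a \<in> N" "act s a \<in> M" for s t
        using V(3)[rule_format, OF _ NM(5)[OF ts]] ts(1,2) by (simp add: inv_mult_group)
      then show ?thesis using NM(1-4) unfolding aa_entourage_def by blast
    qed
    moreover have "aa_entourage a V \<in> aa_entourages" using a V unfolding aa_entourages_def by blast
    ultimately show ?thesis unfolding R by blast
  qed
  show "\<exists>Q\<in>aa_entourages. Q O Q \<subseteq> R"
  proof -
    obtain V where V: "openin X V" "a \<in> V"
      "\<forall>s\<in>carrier T. \<forall>t\<in>carrier T. act s a \<in> V \<longrightarrow> act t a \<in> V \<longrightarrow> act (s \<otimes> t) a \<in> U"
      using aa_point_product[OF a U] by blast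
    have "(x, z) \<in> aa_entourage a U"
      if xy: "(x, y) \<in> aa_entourage a V" and yz: "(y, z) \<in> aa_entourage a V" for x y z
    proof -
      obtain N M where NM: "openin X N" "openin X M" "x \<in> N" "y \<in> M"
        "\<And>t s. \<lbrakk>t \<in> carrier T; s \<in> carrier T; act t a \<in> N; act s a \<in> M\<rbrakk> \<Longrightarrow> act (inv t \<otimes> s) a \<in> V"
        using xy unfolding aa_entourage_def by blast
      obtain M' K where MK: "openin X M'" "openin X K" "y \<in> M'" "z \<in> K"
        "\<And>t s. \<lbrakk>t \<in> carrier T; s \<in> carrier T; act t a \<in> M'; act s a \<in> K\<rbrakk> \<Longrightarrow> act (inv t \<otimes> s) a \<in> V"
        using yz unfolding aa_entourage_def by blast
      \<comment> \<open>An orbit point \<open>act q a\<close> near the middle point \<open>y\<close>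
        splits \<open>inv t \<otimes> s\<close> into \<open>inv t \<otimes> q\<close> times
        \<open>inv q \<otimes> s\<close>.\<close>
      have "openin X (M \<inter> M')" "M \<inter> M' \<noteq> {}" using NM MK by auto
      then obtain q where q: "q \<in> carrier T" "act q a \<in> M" "act q a \<in> M'"
        using dense[OF aX] by blast
      have "act (inv t \<otimes> s) a \<in> U"
        if ts: "t \<in> carrier T" "s \<in> carrier T" "act t a \<in> N" "act s a \<in> K" for t s
      proof -
        have "act (inv t \<otimes> q \<otimes> (inv q \<otimes> s)) a \<in> U"
          using NM(5)[OF ts(1) q(1) ts(3) q(2)] MK(5)[OF q(1) ts(2) q(3) ts(4)] ts(1,2) q(1)
          by (intro V(3)[rule_format]) auto
        moreover have "inv t \<otimes> q \<otimes> (inv q \<otimes> s) = inv t \<otimes> s"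
        proof -
          have "q \<otimes> (inv q \<otimes> s) = s" using ts q by (simp flip: m_assoc)
          then show ?thesis using ts q by (simp add: m_assoc)
        qed
        ultimately show ?thesis by simp
      qed
      then show ?thesis using NM(1-4) MK(1-4) unfolding aa_entourage_def by blast
    qed
    moreover have "aa_entourage a V \<in> aa_entourages" using a V unfolding aa_entourages_def by blast
    ultimately show ?thesis unfolding R by blast
  qed
qed

text \<open>Take \<open>\<one>\<close> for the first group element, which is allowed since
  \<open>a \<in> N\<close>: all orbit points of \<open>a\<close> near \<open>y\<close> then lie in
  \<open>U\<close>. The orbit is dense, so \<open>U\<close> cannot miss a neighbourhood of
  \<open>y\<close>.\<close>

lemma (in group_flow) aa_entourages_separate:
  assumes a: "a \<in> aa_points T X act" and dense: "dense_orbit T X act a" and y: "y \<in> topspace X"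
    and close: "\<And>R. R \<in> aa_entourages \<Longrightarrow> (a, y) \<in> R"
  shows "y = a"
proof (rule ccontr)
  assume "y \<noteq> a"
  moreover have aX: "a \<in> topspace X" using a aa_points_subset by blast
  ultimately obtain U V where UV: "openin X U" "openin X V" "a \<in> U" "y \<in> V" "disjnt U V"
    using Hausdorff y unfolding Hausdorff_space_def by metis
  then have "(a, y) \<in> aa_entourage a U"
    using close a unfolding aa_entourages_def by blast
  then obtain N M where NM: "openin X N" "openin X M" "a \<in> N" "y \<in> M"
      "\<And>t s. \<lbrakk>t \<in> carrier T; s \<in> carrier T; act t a \<in> N; act s a \<in> M\<rbrakk> \<Longrightarrow> act (inv t \<otimes> s) a \<in> U"
    unfolding aa_entourage_def by blast
  have "openin X (M \<inter> V)" "M \<inter> V \<noteq> {}" using NM UV by auto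
  then obtain s where s: "s \<in> carrier T" "act s a \<in> M" "act s a \<in> V"
    using dense unfolding dense_orbit_iff[OF aX] by blast
  then have "act s a \<in> U"
    using NM(5)[of \<one> s] NM(3) aX by (simp add: act_one)
  then show False using s UV(5) by (auto simp: disjnt_iff)
qed

section \<open>Almost automorphic points and the fibres of the quotient map\<close>

theorem theorem0p13:
  fixes T :: "('g, 'm) monoid_scheme" and \<tau> :: "'g topology"
    and X :: "'x topology" and act :: "'g \<Rightarrow> 'x \<Rightarrow> 'x"
  assumes "aa_flow T \<tau> X act"
  shows "\<exists>(Y :: 'x set topology) actY \<pi>.
           flow T \<tau> Y actY \<and> equicontinuous_semiflow T \<tau> Y actY \<and>
           epimorphism T X act Y actY \<pi> \<and>
           almost_one_to_one_extension T \<tau> X act Y actY \<pi> \<and>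
           aa_points T X act = {x \<in> topspace X. fibre X \<pi> (\<pi> x) = {x}}"
proof -
  interpret group_flow T \<tau> X act
    using assms by unfold_locales (simp add: aa_flow_def aa_semiflow_def flow_def)
  obtain a where a: "a \<in> aa_points T X act" "dense_orbit T X act a"
    using assms by (auto simp: aa_flow_def aa_semiflow_def)
  then have min: "minimal_semiflow T \<tau> X act" by (rule minimal_if_aa_dense)
  then interpret invariant_entourages T \<tau> X act aa_entourages
    by (rule invariant_entourages_aa)
  have fib: "fibre X \<pi> (\<pi> x) = {x}" if x: "x \<in> aa_points T X act" for x
  proof -
    have xX: "x \<in> topspace X" using x aa_points_subset by blast
    \<comment> \<open>By minimality the separation argument applies to every almost automorphic
      point, not only to \<open>a\<close>.\<close>
    then have dense: "dense_orbit T X act x" using min by (simp add: minimal_semiflow_def)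
    have "y = x" if "y \<in> topspace X" "\<pi> y = \<pi> x" for y
      using aa_entourages_separate[OF x dense that(1)] that \<pi>_eq_iff[OF xX that(1)] by simp
    then show ?thesis using xX by (auto simp: fibre_def)
  qed
  have "\<pi> a \<in> topspace Y"
    using a(1) aa_points_subset by (auto simp: topspace_Y)
  then have "almost_one_to_one_extension T \<tau> X act Y actY \<pi>"
    unfolding almost_one_to_one_extension_def
    using min minimal_Y epimorphism_\<pi> fib[OF a(1)] by blast
  moreover have "aa_points T X act = {x \<in> topspace X. fibre X \<pi> (\<pi> x) = {x}}"
    using fib aa_point_if_singleton_fibre aa_points_subset by blast
  ultimately show ?thesis
    using flow_Y equicontinuous_Y epimorphism_\<pi> by blast
qed

end
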